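(* Consider the nonparametric regression model $Y_i=f_0(\mathbf X_i)+\varepsilon_i$, $i=1,\ldots,n$, with $\mathbf X_i$ drawn from a distribution with Lebesgue density on $[0,1]^d$ which is lower and upper bounded by positive constants. For any non-negative integer $q$, any dimension vectors $\mathbf d=(d_0,\ldots,d_{q+1})$ (with $d_0=d$, $d_{q+1}=1$) and $\mathbf t=(t_0,\ldots,t_q)$ (with $1\le t_i\le d_i$) satisfying $t_i\le\min(d_0,\ldots,d_{i-1})$ for all $i$ (for $i=0$ this condition is void), any smoothness vector $\boldsymbol\beta=(\beta_0,\ldots,\beta_q)\in(0,\infty)^{q+1}$ and all sufficiently large constants $K>0$, there exists a positive constant $c$ (not depending on $n$) such that $$\inf_{\widehat f_n}\ \sup_{f_0\in\mathcal G(q,\mathbf d,\mathbf t,\boldsymbol\beta,K)}R(\widehat f_n,f_0)\ge c\,\phi_n,$$ where the infimum is taken over all estimators $\widehat f_n$ and $$\phi_n:=\max_{i=0,\ldots,q}n^{-\frac{2\beta_i^*}{2\beta_i^*+t_i}},\qquad\beta_i^*:=\beta_i\prod_{\ell=i+1}^q(\beta_\ell\wedge1).$$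
   Context: Regression model: $\mathbf X_1,\ldots,\mathbf X_n\in[0,1]^d$ are i.i.d., $\varepsilon_1,\ldots,\varepsilon_n$ are i.i.d. standard normal and independent of $(\mathbf X_i)_i$, and $Y_i=f_0(\mathbf X_i)+\varepsilon_i$. An estimator $\widehat f_n$ is any measurable function of the data $(\mathbf X_i,Y_i)_{i\le n}$ with values in real functions on $[0,1]^d$. Its risk is $R(\widehat f_n,f_0):=E_{f_0}[(\widehat f_n(\mathbf X)-f_0(\mathbf X))^2]$, where $\mathbf X$ has the distribution of $\mathbf X_1$ and is independent of the sample, and $E_{f_0}$ is the expectation when the regression function is $f_0$. Hölder balls: $\lfloor\beta\rfloor$ denotes the largest integer strictly smaller than $\beta$. For $D\subset\mathbb R^r$, $\mathcal C_r^\beta(D,K)$ is the set of $f:D\to\mathbb R$ with $$\sum_{\boldsymbol\alpha:|\boldsymbol\alpha|<\beta}\|\partial^{\boldsymbol\alpha}f\|_\infty+\sum_{\boldsymbol\alpha:|\boldsymbol\alpha|=\lfloor\beta\rfloor}\ \sup_{\mathbf x\ne\mathbf y\in D}\frac{|\partial^{\boldsymbol\alpha}f(\mathbf x)-\partial^{\boldsymbol\alpha}f(\mathbf y)|}{|\mathbf x-\mathbf y|_\infty^{\beta-\lfloor\beta\rfloor}}\le K,$$ with multi-indices $\boldsymbol\alpha$ of nonnegative integers and $|\boldsymbol\alpha|=|\boldsymbol\alpha|_1$. Composition class: $\mathcal G(q,\mathbf d,\mathbf t,\boldsymbol\beta,K)$ is the set of $f=g_q\circ\cdots\circ g_0$ with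 $g_i=(g_{ij})_{j=1,\ldots,d_{i+1}}:[a_i,b_i]^{d_i}\to[a_{i+1},b_{i+1}]^{d_{i+1}}$ for some $|a_i|,|b_i|\le K$ (with $a_0=0,b_0=1$), where each $g_{ij}$ depends on at most $t_i$ of its $d_i$ arguments and, as a $t_i$-variate function, $g_{ij}\in\mathcal C_{t_i}^{\beta_i}([a_i,b_i]^{t_i},K)$. *)

theory Defs
  imports "HOL-Probability.Probability"
begin

text \<open>
  The dimensions vary with the layer of the composition, so a point of \<open>\<real>\<^sup>r\<close> is a function on
  \<open>{..<r}\<close> that is \<^const>\<open>undefined\<close> elsewhere, as in \<^const>\<open>PiM\<close>; equality of such functions is
  equality of vectors. All coordinates are numbered from 0. A function on a cube is represented by
  any HOL function with the right values there; its values off the cube never matter.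
\<close>

definition cube :: "real \<Rightarrow> real \<Rightarrow> nat \<Rightarrow> (nat \<Rightarrow> real) set" where
  "cube a b r = {..<r} \<rightarrow>\<^sub>E {a..b}"


section \<open>Hoelder balls\<close>

text \<open>
  The largest integer strictly smaller than \<open>\<beta>\<close>, for \<open>\<beta> > 0\<close>. It differs from \<^const>\<open>floor\<close>
  at the integers.
\<close>

definition strict_floor :: "real \<Rightarrow> nat" where
  "strict_floor \<beta> = nat (\<lceil>\<beta>\<rceil> - 1)"

definition multi_indices :: "nat \<Rightarrow> (nat \<Rightarrow> nat) set" where
  "multi_indices r = {..<r} \<rightarrow>\<^sub>E UNIV"

definition multi_order :: "nat \<Rightarrow> (nat \<Rightarrow> nat) \<Rightarrow> nat" where
  "multi_order r \<alpha> = (\<Sum>i<r. \<alpha> i)"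

text \<open>
  Derivatives on a closed cube are taken within the cube, hence are one-sided on the faces.
  They are determined by the function only when \<open>a < b\<close>.
\<close>

definition partial_deriv ::
    "real \<Rightarrow> real \<Rightarrow> nat \<Rightarrow> ((nat \<Rightarrow> real) \<Rightarrow> real) \<Rightarrow> (nat \<Rightarrow> real) \<Rightarrow> real" where
  "partial_deriv a b i f x = vector_derivative (\<lambda>s. f (x(i := s))) (at (x i) within {a..b})"

definition multi_deriv ::
    "real \<Rightarrow> real \<Rightarrow> nat \<Rightarrow> (nat \<Rightarrow> nat) \<Rightarrow> ((nat \<Rightarrow> real) \<Rightarrow> real) \<Rightarrow> (nat \<Rightarrow> real) \<Rightarrow> real" where
  "multi_deriv a b r \<alpha> f = fold (\<lambda>i. partial_deriv a b i ^^ \<alpha> i) [0..<r] f"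

text \<open>
  Existence of all iterated partial derivatives up to order \<open>k\<close>, in every order of differentiation;
  this is needed because \<^const>\<open>vector_derivative\<close> is total.
\<close>

definition partially_differentiable ::
    "real \<Rightarrow> real \<Rightarrow> nat \<Rightarrow> nat \<Rightarrow> ((nat \<Rightarrow> real) \<Rightarrow> real) \<Rightarrow> bool" where
  "partially_differentiable a b r k f \<longleftrightarrow>
     (\<forall>js i x. set js \<subseteq> {..<r} \<and> length js < k \<and> i < r \<and> x \<in> cube a b r \<longrightarrow>
        (\<lambda>s. fold (partial_deriv a b) js f (x(i := s))) differentiable (at (x i) within {a..b}))"

definition sup_norm :: "(nat \<Rightarrow> real) set \<Rightarrow> ((nat \<Rightarrow> real) \<Rightarrow> real) \<Rightarrow> ennreal" where
  "sup_norm D f = (SUP x\<in>D. ennreal \<bar>f x\<bar>)"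

definition sup_dist :: "nat \<Rightarrow> (nat \<Rightarrow> real) \<Rightarrow> (nat \<Rightarrow> real) \<Rightarrow> real" where
  "sup_dist r x y = Max ((\<lambda>i. \<bar>x i - y i\<bar>) ` {..<r})"

definition holder_seminorm ::
    "nat \<Rightarrow> real \<Rightarrow> (nat \<Rightarrow> real) set \<Rightarrow> ((nat \<Rightarrow> real) \<Rightarrow> real) \<Rightarrow> ennreal" where
  "holder_seminorm r \<gamma> D f =
     (SUP (x, y) \<in> {(x, y). x \<in> D \<and> y \<in> D \<and> x \<noteq> y}.
        ennreal (\<bar>f x - f y\<bar> / sup_dist r x y powr \<gamma>))"

definition holder_norm ::
    "real \<Rightarrow> real \<Rightarrow> nat \<Rightarrow> real \<Rightarrow> ((nat \<Rightarrow> real) \<Rightarrow> real) \<Rightarrow> ennreal" where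
  "holder_norm a b r \<beta> f =
     (\<Sum>\<alpha> \<in> {\<alpha> \<in> multi_indices r. real (multi_order r \<alpha>) < \<beta>}.
        sup_norm (cube a b r) (multi_deriv a b r \<alpha> f)) +
     (\<Sum>\<alpha> \<in> {\<alpha> \<in> multi_indices r. multi_order r \<alpha> = strict_floor \<beta>}.
        holder_seminorm r (\<beta> - real (strict_floor \<beta>)) (cube a b r) (multi_deriv a b r \<alpha> f))"

definition holder_ball ::
    "real \<Rightarrow> real \<Rightarrow> nat \<Rightarrow> real \<Rightarrow> real \<Rightarrow> ((nat \<Rightarrow> real) \<Rightarrow> real) set" where
  "holder_ball a b r \<beta> K =
     {f. partially_differentiable a b r (strict_floor \<beta>) f \<and> holder_norm a b r \<beta> f \<le> ennreal K}"


section \<open>Compositions of sparse smooth functions\<close>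

text \<open>
  \<open>\<sigma>\<close> lists the \<open>t\<close> arguments that \<open>f\<close> may depend on, and \<open>h\<close> is \<open>f\<close> viewed as a
  \<open>t\<close>-variate function; \<open>h\<close> may ignore arguments, so this covers functions of fewer than \<open>t\<close>
  arguments.
\<close>

definition sparse_holder ::
    "real \<Rightarrow> real \<Rightarrow> nat \<Rightarrow> nat \<Rightarrow> real \<Rightarrow> real \<Rightarrow> ((nat \<Rightarrow> real) \<Rightarrow> real) set" where
  "sparse_holder a b r t \<beta> K =
     {f. \<exists>\<sigma> h. inj_on \<sigma> {..<t} \<and> \<sigma> ` {..<t} \<subseteq> {..<r} \<and> h \<in> holder_ball a b t \<beta> K \<and>
           (\<forall>x \<in> cube a b r. f x = h (\<lambda>k\<in>{..<t}. x (\<sigma> k)))}"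

text \<open>
  Here \<open>fold g [0..<Suc q]\<close> is \<open>g q \<circ> \<dots> \<circ> g 0\<close>, and component 0 is the only one of its value
  when \<open>d (Suc q) = 1\<close>. The strict inequality \<open>a i < b i\<close> excludes one-point cubes, on which
  derivatives are meaningless. It removes no \<open>f\<close> from the class when \<open>K > 0\<close>: passing through a
  one-point cube makes \<open>f\<close> a constant of modulus at most \<open>K\<close>, and these belong to the class anyway.
\<close>

definition composition_class ::
    "nat \<Rightarrow> (nat \<Rightarrow> nat) \<Rightarrow> (nat \<Rightarrow> nat) \<Rightarrow> (nat \<Rightarrow> real) \<Rightarrow> real \<Rightarrow> ((nat \<Rightarrow> real) \<Rightarrow> real) set" where
  "composition_class q d t \<beta> K =
     {f. \<exists>a b g.
        a 0 = 0 \<and> b 0 = 1 \<and>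
        (\<forall>i \<le> Suc q. a i < b i \<and> \<bar>a i\<bar> \<le> K \<and> \<bar>b i\<bar> \<le> K) \<and>
        (\<forall>i \<le> q. g i \<in> cube (a i) (b i) (d i) \<rightarrow> cube (a (Suc i)) (b (Suc i)) (d (Suc i))) \<and>
        (\<forall>i \<le> q. \<forall>j < d (Suc i).
           (\<lambda>x. g i x j) \<in> sparse_holder (a i) (b i) (d i) (t i) (\<beta> i) K) \<and>
        (\<forall>x \<in> cube 0 1 (d 0). f x = fold g [0..<Suc q] x 0)}"


section \<open>The regression model\<close>

definition lebesgue_cube :: "nat \<Rightarrow> (nat \<Rightarrow> real) measure" where
  "lebesgue_cube d = restrict_space (Pi\<^sub>M {..<d} (\<lambda>_. lborel)) (cube 0 1 d)"

definition std_normal :: "real measure" where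
  "std_normal = density lborel (\<lambda>x. ennreal (std_normal_density x))"

text \<open>
  The joint law of the design points, the noise variables and the new point \<open>X\<close>, when the design
  points have law \<open>P\<close>.
\<close>

definition model_law ::
    "(nat \<Rightarrow> real) measure \<Rightarrow> nat \<Rightarrow> ((nat \<Rightarrow> nat \<Rightarrow> real) \<times> (nat \<Rightarrow> real) \<times> (nat \<Rightarrow> real)) measure" where
  "model_law P n = Pi\<^sub>M {..<n} (\<lambda>_. P) \<Otimes>\<^sub>M (Pi\<^sub>M {..<n} (\<lambda>_. std_normal) \<Otimes>\<^sub>M P)"

definition sample ::
    "nat \<Rightarrow> ((nat \<Rightarrow> real) \<Rightarrow> real) \<Rightarrow> (nat \<Rightarrow> nat \<Rightarrow> real) \<Rightarrow> (nat \<Rightarrow> real) \<Rightarrow> nat \<Rightarrow> (nat \<Rightarrow> real) \<times> real" where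
  "sample n f0 X \<epsilon> = (\<lambda>i\<in>{..<n}. (X i, f0 (X i) + \<epsilon> i))"

text \<open>
  Estimators are jointly measurable in the sample and the point of evaluation, which is what the
  risk needs in order to be defined.
\<close>

definition estimators ::
    "nat \<Rightarrow> nat \<Rightarrow> ((nat \<Rightarrow> (nat \<Rightarrow> real) \<times> real) \<Rightarrow> (nat \<Rightarrow> real) \<Rightarrow> real) set" where
  "estimators d n =
     {est. (\<lambda>(z, x). est z x) \<in> borel_measurable
        (Pi\<^sub>M {..<n} (\<lambda>_. lebesgue_cube d \<Otimes>\<^sub>M borel) \<Otimes>\<^sub>M lebesgue_cube d)}"

definition risk ::
    "(nat \<Rightarrow> real) measure \<Rightarrow> nat \<Rightarrow> ((nat \<Rightarrow> (nat \<Rightarrow> real) \<times> real) \<Rightarrow> (nat \<Rightarrow> real) \<Rightarrow> real) \<Rightarrow>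
     ((nat \<Rightarrow> real) \<Rightarrow> real) \<Rightarrow> ennreal" where
  "risk P n est f0 =
     (\<integral>\<^sup>+ (X, \<epsilon>, x). ennreal ((est (sample n f0 X \<epsilon>) x - f0 x)\<^sup>2) \<partial>model_law P n)"


section \<open>The rate\<close>

definition effective_smoothness :: "nat \<Rightarrow> (nat \<Rightarrow> real) \<Rightarrow> nat \<Rightarrow> real" where
  "effective_smoothness q \<beta> i = \<beta> i * (\<Prod>l\<in>{i<..q}. min (\<beta> l) 1)"

definition rate :: "nat \<Rightarrow> (nat \<Rightarrow> nat) \<Rightarrow> (nat \<Rightarrow> real) \<Rightarrow> nat \<Rightarrow> real" where
  "rate q t \<beta> n =
     Max ((\<lambda>i. real n powr
        (- (2 * effective_smoothness q \<beta> i) / (2 * effective_smoothness q \<beta> i + real (t i)))) ` {..q})"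

end

theory Submission
  imports Defs
begin

text \<open>
  It suffices to bound the minimax risk from below by each term
  \<open>n powr (- 2 b' / (2 b' + t))\<close> of the maximum separately, where \<open>l\<close> is the layer of the term,
  \<open>b = \<beta> l\<close>, \<open>t = t l\<close>, \<open>B\<close> is the product of \<open>min (\<beta> i) 1\<close> over \<open>i > l\<close> and \<open>b' = b B\<close>.

  Divide the cube of the first \<open>t\<close> coordinates into \<open>m ^ t\<close> cells of side \<open>1/m\<close>. On each cell put
  a smooth bump of height about \<open>m powr (-b)\<close> which vanishes outside the cell. The scaling is such
  that every sum of bumps over a set \<open>W\<close> of cells lies in one Hoelder ball of smoothness \<open>b\<close>, uniformly
  in \<open>m\<close> and \<open>W\<close> (\<open>bump_sum_in_holder_ball\<close>). Such a sum is used as the layer \<open>l\<close> of a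
  composition. The layers before it only hand on the first \<open>t\<close> coordinates, which is possible since
  \<open>t\<close> is at most each of the earlier dimensions. The later layers map \<open>y\<close> to \<open>y powr min (\<beta> i) 1\<close>,
  a function that is \<open>\<beta> i\<close>-smooth and, up to a constant, as steep at 0 as that smoothness permits
  (\<open>single_layer_in_composition_class\<close>). The composition is thus the \<open>B\<close>-th power of the sum. As the
  bumps have disjoint supports, it is again a sum of disjoint perturbations, one for each cell of \<open>W\<close>,
  now of height about \<open>m powr (-b')\<close> (\<open>sum_peak_eq\<close>).

  This family is a hypercube, indexed by the sets \<open>W\<close> of cells, and Assouad's argument applies
  (\<open>assouad_lower_bound\<close>). Whether a cell belongs to \<open>W\<close> can be read off only from the design points
  in that cell. If \<open>n\<close> times the squared \<open>L\<^sup>2\<close> norm of one perturbation is at most 1, no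
  test decides this reliably, and on every cell an estimator errs, on average over \<open>W\<close>, by a
  constant fraction of the energy of its perturbation. The two-point comparison behind this
  (\<open>two_point_gaussian\<close>) rewrites the risk under one regression function as a risk under the
  other, weighted by a Gaussian likelihood ratio.

  One perturbation has energy of order \<open>m powr (- (2 b' + t))\<close>, since the design density is bounded
  above and below. So \<open>m\<close> may be chosen of order \<open>n powr (1 / (2 b' + t))\<close>, and the total energy of
  the \<open>m ^ t\<close> cells is then of order \<open>m powr (- 2 b')\<close>, which is the required rate
  (\<open>single_layer_lower_bound\<close>).
\<close>


section \<open>Hoelder balls through tables of derivatives\<close>

lemma cube_upd: "x \<in> cube a b r \<Longrightarrow> i < r \<Longrightarrow> s \<in> {a..b} \<Longrightarrow> x(i := s) \<in> cube a b r"
  by (auto simp: cube_def PiE_iff extensional_def)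

lemma cube_coord: "x \<in> cube a b r \<Longrightarrow> i < r \<Longrightarrow> x i \<in> {a..b}"
  by (auto simp: cube_def PiE_iff)

text \<open>
  A family \<open>D\<close> of candidates for the partial derivatives of \<open>D (\<lambda>_. 0)\<close>, indexed by how often
  each coordinate has been differentiated. As the order of the differentiations leaves no trace in
  the index, one table describes all iterated partial derivatives at once.
\<close>

definition derivative_table ::
    "real \<Rightarrow> real \<Rightarrow> nat \<Rightarrow> nat \<Rightarrow> ((nat \<Rightarrow> nat) \<Rightarrow> (nat \<Rightarrow> real) \<Rightarrow> real) \<Rightarrow> bool" where
  "derivative_table a b r k D \<longleftrightarrow>
     (\<forall>\<alpha> i x. multi_order r \<alpha> < k \<and> i < r \<and> x \<in> cube a b r \<longrightarrow>
        ((\<lambda>s. D \<alpha> (x(i := s))) has_vector_derivative D (\<alpha>(i := Suc (\<alpha> i))) x)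
          (at (x i) within {a..b}))"

lemma count_list_snoc: "count_list (js @ [i]) = (count_list js)(i := Suc (count_list js i))"
  by (auto simp: fun_eq_iff)

lemma multi_order_zero [simp]: "multi_order r (\<lambda>_. 0) = 0"
  by (simp add: multi_order_def)

lemma multi_order_Suc:
  assumes "i < r"
  shows "multi_order r (\<alpha>(i := Suc (\<alpha> i))) = Suc (multi_order r \<alpha>)"
proof -
  have "(\<Sum>j<r. (\<alpha>(i := Suc (\<alpha> i))) j) = (\<Sum>j<r. \<alpha> j + (if j = i then 1 else 0))"
    by (intro sum.cong) auto
  then show ?thesis
    using assms by (simp add: multi_order_def sum.distrib)
qed

lemma multi_order_count_list:
  "set js \<subseteq> {..<r} \<Longrightarrow> multi_order r (count_list js) = length js"
  unfolding multi_order_def by (rule sum_count_set) auto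

text \<open>
  Partial derivatives within the cube depend only on the values on the cube, so a function that
  agrees with a table entry there can be differentiated like it. Nothing can be said about the
  iterated derivatives off the cube.
\<close>

lemma derivative_table_step:
  assumes D: "derivative_table a b r k D" and "multi_order r \<alpha> < k" "i < r" "x \<in> cube a b r"
    and F: "\<And>y. y \<in> cube a b r \<Longrightarrow> F y = D \<alpha> y"
  shows "((\<lambda>s. F (x(i := s))) has_vector_derivative D (\<alpha>(i := Suc (\<alpha> i))) x) (at (x i) within {a..b})"
proof (rule has_vector_derivative_transform)
  show "x i \<in> {a..b}" using assms cube_coord by blast
  show "F (x(i := s)) = D \<alpha> (x(i := s))" if "s \<in> {a..b}" for s
    using assms that by (intro F cube_upd)
  show "((\<lambda>s. D \<alpha> (x(i := s))) has_vector_derivative D (\<alpha>(i := Suc (\<alpha> i))) x) (at (x i) within {a..b})"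
    using assms unfolding derivative_table_def by blast
qed

lemma fold_partial_deriv_eq_table:
  assumes "a < b" and D: "derivative_table a b r k D"
    and "set js \<subseteq> {..<r}" and "length js \<le> k" and "x \<in> cube a b r"
  shows "fold (partial_deriv a b) js (D (\<lambda>_. 0)) x = D (count_list js) x"
  using assms(3-5)
proof (induction js arbitrary: x rule: rev_induct)
  case Nil
  then show ?case by simp
next
  case (snoc i js)
  let ?F = "fold (partial_deriv a b) js (D (\<lambda>_. 0))"
  have "((\<lambda>s. ?F (x(i := s))) has_vector_derivative D (count_list (js @ [i])) x)
      (at (x i) within {a..b})"
    unfolding count_list_snoc using snoc.prems multi_order_count_list[of js r]
    by (intro derivative_table_step[OF D] snoc.IH) auto
  moreover have "x i \<in> {a..b}" using snoc.prems by (intro cube_coord[of x a b r]) auto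
  ultimately have "partial_deriv a b i ?F x = D (count_list (js @ [i])) x"
    unfolding partial_deriv_def[of a b i ?F x]
    by (intro vector_derivative_within_closed_interval \<open>a < b\<close>)
  then show ?case by (simp del: count_list_append)
qed

text \<open>
  The derivative \<open>multi_deriv\<close> differentiates coordinate after coordinate; it is the iterated
  derivative along the sorted list that contains each coordinate \<open>i\<close> exactly \<open>\<alpha> i\<close> times.
\<close>

lemma multi_deriv_eq_fold:
  "multi_deriv a b r \<alpha> f = fold (partial_deriv a b) (concat (map (\<lambda>i. replicate (\<alpha> i) i) [0..<r])) f"
proof -
  have "fold (\<lambda>i. partial_deriv a b i ^^ \<alpha> i) is f =
    fold (partial_deriv a b) (concat (map (\<lambda>i. replicate (\<alpha> i) i) is)) f" for "is"
    by (induction "is" arbitrary: f) auto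
  then show ?thesis by (simp add: multi_deriv_def)
qed

lemma length_multi_index_list:
  "length (concat (map (\<lambda>i. replicate (\<alpha> i) i) [0..<r])) = multi_order r \<alpha>"
  by (simp add: length_concat comp_def multi_order_def interv_sum_list_conv_sum_set_nat lessThan_atLeast0)

text \<open>
  The number of summands in the Hoelder norm: a bound \<open>C\<close> on each of them bounds the norm by
  \<open>C\<close> times this number.
\<close>

definition holder_terms :: "nat \<Rightarrow> real \<Rightarrow> nat" where
  "holder_terms r \<beta> = card {\<alpha> \<in> multi_indices r. real (multi_order r \<alpha>) < \<beta>} +
     card {\<alpha> \<in> multi_indices r. multi_order r \<alpha> = strict_floor \<beta>}"

lemma strict_floor_bounds:
  assumes "0 < \<beta>"
  shows "real (strict_floor \<beta>) < \<beta>" "\<beta> \<le> real (strict_floor \<beta>) + 1"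
    "real n < \<beta> \<longleftrightarrow> n \<le> strict_floor \<beta>"
  using assms unfolding strict_floor_def by linarith+

lemma holder_ballI:
  assumes "a < b" and "0 < \<beta>" and "0 \<le> C" and D: "derivative_table a b r (strict_floor \<beta>) D"
    and sup: "\<And>\<alpha> x. multi_order r \<alpha> \<le> strict_floor \<beta> \<Longrightarrow> x \<in> cube a b r \<Longrightarrow> \<bar>D \<alpha> x\<bar> \<le> C"
    and hol: "\<And>\<alpha> x y. multi_order r \<alpha> = strict_floor \<beta> \<Longrightarrow> x \<in> cube a b r \<Longrightarrow> y \<in> cube a b r \<Longrightarrow>
      \<bar>D \<alpha> x - D \<alpha> y\<bar> \<le> C * sup_dist r x y powr (\<beta> - real (strict_floor \<beta>))"
    and K: "C * real (holder_terms r \<beta>) \<le> K"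
  shows "D (\<lambda>_. 0) \<in> holder_ball a b r \<beta> K"
proof -
  let ?s = "strict_floor \<beta>" and ?f = "D (\<lambda>_. 0)"
  have md: "\<exists>\<alpha>'. multi_order r \<alpha>' = multi_order r \<alpha> \<and>
      (\<forall>x\<in>cube a b r. multi_deriv a b r \<alpha> ?f x = D \<alpha>' x)"
    if "multi_order r \<alpha> \<le> ?s" for \<alpha>
  proof -
    define js where "js = concat (map (\<lambda>i. replicate (\<alpha> i) i) [0..<r])"
    have js: "set js \<subseteq> {..<r}" "length js = multi_order r \<alpha>"
      using length_multi_index_list[of \<alpha> r] by (auto simp: js_def)
    have "multi_deriv a b r \<alpha> ?f x = D (count_list js) x" if "x \<in> cube a b r" for x
      unfolding multi_deriv_eq_fold js_def[symmetric]
      using js \<open>multi_order r \<alpha> \<le> ?s\<close> that fold_partial_deriv_eq_table[OF \<open>a < b\<close> D, of js x] by simp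
    then show ?thesis
      using js multi_order_count_list[of js r] by (intro exI[of _ "count_list js"]) simp
  qed
  have "partially_differentiable a b r ?s ?f"
    unfolding partially_differentiable_def
  proof (intro allI impI)
    fix js i x assume *: "set js \<subseteq> {..<r} \<and> length js < ?s \<and> i < r \<and> x \<in> cube a b r"
    let ?F = "fold (partial_deriv a b) js ?f"
    have "((\<lambda>s. ?F (x(i := s))) has_vector_derivative
        D ((count_list js)(i := Suc (count_list js i))) x) (at (x i) within {a..b})"
      using * multi_order_count_list[of js r] fold_partial_deriv_eq_table[OF \<open>a < b\<close> D, of js]
      by (intro derivative_table_step[OF D]) auto
    then show "(\<lambda>s. ?F (x(i := s))) differentiable at (x i) within {a..b}"
      by (rule differentiableI_vector)
  qed
  moreover have "holder_norm a b r \<beta> ?f \<le> ennreal K"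
  proof -
    have 1: "sup_norm (cube a b r) (multi_deriv a b r \<alpha> ?f) \<le> ennreal C"
      if "real (multi_order r \<alpha>) < \<beta>" for \<alpha>
      unfolding sup_norm_def
    proof (intro SUP_least ennreal_leI)
      fix x assume x: "x \<in> cube a b r"
      have "multi_order r \<alpha> \<le> ?s"
        using that strict_floor_bounds(3)[OF \<open>0 < \<beta>\<close>] by simp
      from md[OF this] obtain \<alpha>' where "multi_order r \<alpha>' = multi_order r \<alpha>"
        "multi_deriv a b r \<alpha> ?f x = D \<alpha>' x" using x by blast
      then show "\<bar>multi_deriv a b r \<alpha> ?f x\<bar> \<le> C"
        using sup[of \<alpha>' x] x \<open>multi_order r \<alpha> \<le> ?s\<close> by simp
    qed
    have 2: "holder_seminorm r (\<beta> - real ?s) (cube a b r) (multi_deriv a b r \<alpha> ?f) \<le> ennreal C"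
      if \<alpha>: "multi_order r \<alpha> = ?s" for \<alpha>
      unfolding holder_seminorm_def
    proof (rule SUP_least, clarify, rule ennreal_leI)
      fix x y assume xy: "x \<in> cube a b r" "y \<in> cube a b r"
      have "\<bar>multi_deriv a b r \<alpha> ?f x - multi_deriv a b r \<alpha> ?f y\<bar>
          \<le> C * sup_dist r x y powr (\<beta> - real ?s)"
      proof -
        obtain \<alpha>' where "multi_order r \<alpha>' = multi_order r \<alpha>"
          "\<forall>x\<in>cube a b r. multi_deriv a b r \<alpha> ?f x = D \<alpha>' x"
          using md[of \<alpha>] \<alpha> by auto
        then show ?thesis
          using hol[of \<alpha>' x y] \<alpha> xy by simp
      qed
      then show "\<bar>multi_deriv a b r \<alpha> ?f x - multi_deriv a b r \<alpha> ?f y\<bar>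
          / sup_dist r x y powr (\<beta> - real ?s) \<le> C"
        using \<open>0 \<le> C\<close> by (cases "sup_dist r x y powr (\<beta> - real ?s) = 0") (auto simp: divide_simps)
    qed
    have "holder_norm a b r \<beta> ?f \<le>
        of_nat (card {\<alpha> \<in> multi_indices r. real (multi_order r \<alpha>) < \<beta>}) * ennreal C +
        of_nat (card {\<alpha> \<in> multi_indices r. multi_order r \<alpha> = ?s}) * ennreal C"
      unfolding holder_norm_def using 1 2
      by (intro add_mono sum_bounded_above) auto
    also have "\<dots> = ennreal (C * real (holder_terms r \<beta>))"
      using \<open>0 \<le> C\<close> by (simp add: holder_terms_def ennreal_of_nat_eq_real_of_nat distrib_left
          ennreal_mult ennreal_plus mult.commute)
    finally show ?thesis
      using K by (auto intro: order_trans ennreal_leI)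
  qed
  ultimately show ?thesis by (simp add: holder_ball_def)
qed

lemma holder_ball_mono: "K \<le> K' \<Longrightarrow> f \<in> holder_ball a b r \<beta> K \<Longrightarrow> f \<in> holder_ball a b r \<beta> K'"
  unfolding holder_ball_def using ennreal_leI order_trans by blast

section \<open>Coordinates and powers as Hoelder functions\<close>

lemma sup_dist_ge: "i < r \<Longrightarrow> \<bar>x i - y i\<bar> \<le> sup_dist r x y"
  unfolding sup_dist_def by (intro Max_ge) auto

lemma sup_dist_nonneg: "0 < r \<Longrightarrow> 0 \<le> sup_dist r x y"
  using sup_dist_ge[of 0 r x y] by linarith

lemma le_powr_unit_exponent:
  fixes x \<gamma> :: real
  assumes "0 \<le> x" "x \<le> 1" "0 < \<gamma>" "\<gamma> \<le> 1"
  shows "x \<le> x powr \<gamma>"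
  using assms powr_mono'[of \<gamma> 1 x] by (cases "x = 0") auto

lemma sup_dist_unit_cube:
  assumes "0 < r" "x \<in> cube 0 1 r" "y \<in> cube 0 1 r"
  shows "sup_dist r x y \<le> 1"
  unfolding sup_dist_def
proof (subst Max_le_iff)
  show "\<forall>a\<in>(\<lambda>i. \<bar>x i - y i\<bar>) ` {..<r}. a \<le> 1"
    using assms cube_coord[of x 0 1 r] cube_coord[of y 0 1 r] by (fastforce simp: abs_le_iff)
qed (use assms in auto)

lemma coordinate_in_holder_ball:
  assumes "0 < r" "0 < \<beta>"
  shows "(\<lambda>y. y 0) \<in> holder_ball 0 1 r \<beta> (real (holder_terms r \<beta>))"
proof -
  define D :: "(nat \<Rightarrow> nat) \<Rightarrow> (nat \<Rightarrow> real) \<Rightarrow> real" where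
    "D \<alpha> y = (if multi_order r \<alpha> = 0 then y 0
              else if multi_order r \<alpha> = 1 \<and> \<alpha> 0 = 1 then 1 else 0)" for \<alpha> y
  have z: "\<alpha> 0 = 0" if "multi_order r \<alpha> = 0" for \<alpha>
    using that \<open>0 < r\<close> by (simp add: multi_order_def)
  have "derivative_table 0 1 r (strict_floor \<beta>) D"
    unfolding derivative_table_def
  proof (intro allI impI, elim conjE)
    fix \<alpha> i x assume "i < r"
    show "((\<lambda>s. D \<alpha> (x(i := s))) has_vector_derivative D (\<alpha>(i := Suc (\<alpha> i))) x)
          (at (x i) within {0..1})"
    proof (cases "multi_order r \<alpha> = 0")
      case True
      have D0: "(\<lambda>s. D \<alpha> (x(i := s))) = (\<lambda>s. if i = 0 then s else x 0)"
        by (auto simp: D_def True)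
      have D1: "D (\<alpha>(i := Suc (\<alpha> i))) x = (if i = 0 then 1 else 0)"
        using z[OF True] unfolding D_def multi_order_Suc[OF \<open>i < r\<close>] True by simp
      show ?thesis
        unfolding D0 D1 by (cases "i = 0") (auto intro!: derivative_eq_intros)
    next
      case False
      have D0: "(\<lambda>s. D \<alpha> (x(i := s))) = (\<lambda>s. D \<alpha> x)"
        by (simp add: D_def False)
      have D1: "D (\<alpha>(i := Suc (\<alpha> i))) x = 0"
        unfolding D_def multi_order_Suc[OF \<open>i < r\<close>] using False by simp
      show ?thesis
        unfolding D0 D1 by simp
    qed
  qed
  moreover have "\<bar>D \<alpha> x\<bar> \<le> 1" if "x \<in> cube 0 1 r" for \<alpha> x
    using cube_coord[OF that \<open>0 < r\<close>] by (auto simp: D_def)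
  moreover have "\<bar>D \<alpha> x - D \<alpha> y\<bar> \<le> 1 * sup_dist r x y powr (\<beta> - real (strict_floor \<beta>))"
    if "x \<in> cube 0 1 r" "y \<in> cube 0 1 r" for \<alpha> x y
  proof -
    have "\<bar>D \<alpha> x - D \<alpha> y\<bar> \<le> sup_dist r x y"
      using sup_dist_ge[OF \<open>0 < r\<close>, of x y] sup_dist_nonneg[OF \<open>0 < r\<close>, of x y] by (auto simp: D_def)
    also have "\<dots> \<le> sup_dist r x y powr (\<beta> - real (strict_floor \<beta>))"
      using strict_floor_bounds[OF \<open>0 < \<beta>\<close>] sup_dist_unit_cube[OF \<open>0 < r\<close> that]
        sup_dist_nonneg[OF \<open>0 < r\<close>, of x y]
      by (intro le_powr_unit_exponent) auto
    finally show ?thesis by simp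
  qed
  ultimately have "D (\<lambda>_. 0) \<in> holder_ball 0 1 r \<beta> (real (holder_terms r \<beta>))"
    using \<open>0 < \<beta>\<close> by (intro holder_ballI[where C = 1]) auto
  then show ?thesis by (simp add: D_def[abs_def] multi_order_def)
qed

text \<open>
  Subadditivity of concave powers. Divided by \<open>(x + y) powr \<gamma>\<close>, it says that two numbers in the unit
  interval with sum 1 do not decrease when raised to a power \<open>\<gamma> \<le> 1\<close>.
\<close>

lemma powr_add_le:
  fixes x y \<gamma> :: real
  assumes "0 \<le> x" "0 \<le> y" "0 < \<gamma>" "\<gamma> \<le> 1"
  shows "(x + y) powr \<gamma> \<le> x powr \<gamma> + y powr \<gamma>"
proof (cases "x + y = 0")
  case False
  define z where "z = x + y"
  have z: "0 < z" using False assms by (simp add: z_def)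
  have "1 = x / z + y / z"
    using z by (simp add: add_divide_distrib[symmetric] z_def)
  also have "\<dots> \<le> (x / z) powr \<gamma> + (y / z) powr \<gamma>"
    using assms z by (intro add_mono le_powr_unit_exponent) (auto simp: z_def)
  also have "\<dots> = (x powr \<gamma> + y powr \<gamma>) / z powr \<gamma>"
    using assms z by (simp add: powr_divide add_divide_distrib)
  finally show ?thesis
    using z by (simp add: z_def[symmetric] field_simps)
qed (use assms in auto)

lemma powr_diff_abs_le:
  fixes x y \<gamma> :: real
  assumes "0 \<le> x" "0 \<le> y" "0 < \<gamma>" "\<gamma> \<le> 1"
  shows "\<bar>x powr \<gamma> - y powr \<gamma>\<bar> \<le> \<bar>x - y\<bar> powr \<gamma>"
  using powr_add_le[of y "x - y" \<gamma>] powr_add_le[of x "y - x" \<gamma>] assms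
    powr_mono2[of \<gamma> x y] powr_mono2[of \<gamma> y x]
  by (cases "x \<le> y") auto

lemma power_in_holder_ball:
  assumes "0 < r" "0 < \<beta>" "\<beta> \<le> 1"
  shows "(\<lambda>y. y 0 powr \<beta>) \<in> holder_ball 0 1 r \<beta> (real (holder_terms r \<beta>))"
proof -
  have s: "strict_floor \<beta> = 0"
    using assms by (simp add: strict_floor_def)
  define D :: "(nat \<Rightarrow> nat) \<Rightarrow> (nat \<Rightarrow> real) \<Rightarrow> real" where "D = (\<lambda>_ y. y 0 powr \<beta>)"
  have "derivative_table 0 1 r (strict_floor \<beta>) D"
    by (simp add: derivative_table_def s)
  moreover have "\<bar>D \<alpha> x\<bar> \<le> 1" if "x \<in> cube 0 1 r" for \<alpha> x
    using cube_coord[OF that \<open>0 < r\<close>] assms by (auto simp: D_def intro!: powr_le1)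
  moreover have "\<bar>D \<alpha> x - D \<alpha> y\<bar> \<le> 1 * sup_dist r x y powr (\<beta> - real (strict_floor \<beta>))"
    if "x \<in> cube 0 1 r" "y \<in> cube 0 1 r" for \<alpha> x y
  proof -
    have "\<bar>D \<alpha> x - D \<alpha> y\<bar> \<le> \<bar>x 0 - y 0\<bar> powr \<beta>"
      using cube_coord[OF that(1) \<open>0 < r\<close>] cube_coord[OF that(2) \<open>0 < r\<close>] assms
      by (auto simp: D_def intro!: powr_diff_abs_le)
    also have "\<dots> \<le> sup_dist r x y powr \<beta>"
      using sup_dist_ge[OF \<open>0 < r\<close>] assms by (intro powr_mono2) auto
    finally show ?thesis by (simp add: s)
  qed
  ultimately have "D (\<lambda>_. 0) \<in> holder_ball 0 1 r \<beta> (real (holder_terms r \<beta>))"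
    using \<open>0 < \<beta>\<close> by (intro holder_ballI[where C = 1]) auto
  then show ?thesis by (simp add: D_def)
qed

section \<open>Bumps on a grid\<close>

text \<open>
  The function \<open>k j\<close> is the \<open>j\<close>-th derivative of a nonnegative bump on the unit interval. All
  derivatives that matter are normalized to be at most 1, so that products of them need no constants;
  the price is that the height of the bump in the middle is only some \<open>\<kappa> > 0\<close>.
\<close>

definition smooth_bump :: "nat \<Rightarrow> real \<Rightarrow> (nat \<Rightarrow> real \<Rightarrow> real) \<Rightarrow> bool" where
  "smooth_bump s \<kappa> k \<longleftrightarrow> 0 < \<kappa> \<and>
     (\<forall>j \<le> s. \<forall>x. (k j has_real_derivative k (Suc j) x) (at x)) \<and>
     (\<forall>j \<le> Suc s. \<forall>x. \<bar>k j x\<bar> \<le> 1) \<and>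
     (\<forall>j \<le> Suc s. \<forall>x. x \<notin> {0<..<1} \<longrightarrow> k j x = 0) \<and>
     (\<forall>x. 0 \<le> k 0 x) \<and> (\<forall>x \<in> {1/4..3/4}. \<kappa> \<le> k 0 x)"

lemma power_dvd_iterated_pderiv:
  fixes p q :: "'a::idom poly"
  assumes "j \<le> n"
  shows "q ^ (n - j) dvd (pderiv ^^ j) (q ^ n)"
  using assms
proof (induction j)
  case (Suc j)
  from Suc obtain r where "(pderiv ^^ j) (q ^ n) = q ^ Suc (n - Suc j) * r"
    by (auto simp: Suc_diff_Suc elim: dvdE)
  then have "(pderiv ^^ Suc j) (q ^ n) =
      q ^ (n - Suc j) * (q * pderiv r + smult (of_nat (Suc (n - Suc j))) (pderiv q) * r)"
    by (simp add: pderiv_mult pderiv_power_Suc algebra_simps del: power_Suc of_nat_Suc)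
       (simp add: algebra_simps)
  then show ?case by simp
qed simp

text \<open>
  A function and its derivative may both be cut off outside the unit interval if both vanish at its
  ends: there the difference quotients of the cut-off function are dominated by those of the
  original one.
\<close>

lemma DERIV_zero_outside_interval:
  fixes f :: "real \<Rightarrow> real"
  assumes f: "\<And>x. (f has_real_derivative f' x) (at x)"
    and 0: "f 0 = 0" "f 1 = 0" "f' 0 = 0" "f' 1 = 0"
  shows "((\<lambda>x. if 0 < x \<and> x < 1 then f x else 0) has_real_derivative
    (if 0 < x \<and> x < 1 then f' x else 0)) (at x)" (is "(?g has_real_derivative _) _")
proof -
  consider "0 < x \<and> x < 1" | "x < 0 \<or> 1 < x" | "x = 0 \<or> x = 1" by linarith
  then show ?thesis
  proof cases
    case 1
    have "(?g has_real_derivative f' x) (at x)"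
      by (rule has_field_derivative_transform_within_open[OF f, where S = "{0<..<1}"]) (use 1 in auto)
    then show ?thesis using 1 by simp
  next
    case 2
    have "(?g has_real_derivative 0) (at x)"
      by (rule has_field_derivative_transform_within_open[of "\<lambda>_. 0" _ _ "- {0..1}"])
        (use 2 in \<open>auto intro: open_Compl\<close>)
    then show ?thesis using 2 by auto
  next
    case 3
    then have fx: "f x = 0" "f' x = 0" "?g x = 0" using 0 by auto
    have "((\<lambda>h. (?g (x + h) - ?g x) / h) \<longlongrightarrow> 0) (at 0)"
    proof (rule Lim_null_comparison)
      show "\<forall>\<^sub>F h in at 0. norm ((?g (x + h) - ?g x) / h) \<le> \<bar>(f (x + h) - f x) / h\<bar>"
        unfolding fx by (intro always_eventually) (auto simp: abs_divide)
      have "((\<lambda>h. (f (x + h) - f x) / h) \<longlongrightarrow> 0) (at 0)"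
        using f[of x] fx by (simp add: DERIV_def)
      then show "((\<lambda>h. \<bar>(f (x + h) - f x) / h\<bar>) \<longlongrightarrow> 0) (at 0)"
        by (rule tendsto_rabs_zero)
    qed
    then show ?thesis using 3 by (auto simp: DERIV_def)
  qed
qed

text \<open>
  The polynomial \<open>(x (1 - x)) ^ (s + 2)\<close> vanishes to order \<open>s + 2\<close> at 0 and 1, so its derivatives up
  to order \<open>s + 1\<close> may all be cut off there. Dividing by a common bound on these derivatives
  normalizes them.
\<close>

lemma smooth_bump_exists: "\<exists>\<kappa> k. smooth_bump s \<kappa> k"
proof -
  define N where "N = s + 2"
  define q :: "real poly" where "q = [:0, 1:] * [:1, -1:]"
  define p where "p j = (pderiv ^^ j) (q ^ N)" for j
  have q: "poly q x = x * (1 - x)" for x by (simp add: q_def)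
  have p0: "poly (p j) 0 = 0" "poly (p j) 1 = 0" if "j \<le> Suc s" for j
  proof -
    have "q dvd q ^ (N - j)" using that by (intro dvd_power) (auto simp: N_def)
    also have "\<dots> dvd p j" unfolding p_def using that by (intro power_dvd_iterated_pderiv) (auto simp: N_def)
    finally show "poly (p j) 0 = 0" "poly (p j) 1 = 0" using q by (auto elim!: dvdE)
  qed
  have "\<exists>C. \<forall>x\<in>{0..1}. \<bar>poly (p j) x\<bar> \<le> C" for j
  proof -
    have "compact ((\<lambda>x. poly (p j) x) ` {0..1})"
      by (intro compact_continuous_image continuous_intros) auto
    then show ?thesis by (auto simp: bounded_iff dest!: compact_imp_bounded)
  qed
  then obtain c where c: "\<And>j x. x \<in> {0..1} \<Longrightarrow> \<bar>poly (p j) x\<bar> \<le> c j" by metis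
  define C where "C = 1 + (\<Sum>j\<le>Suc s. \<bar>c j\<bar>)"
  have "0 \<le> (\<Sum>j\<le>Suc s. \<bar>c j\<bar>)" by (intro sum_nonneg) auto
  then have C: "0 < C" unfolding C_def by linarith
  have cC: "c j \<le> C" if "j \<le> Suc s" for j
  proof -
    have "\<bar>c j\<bar> \<le> (\<Sum>j\<le>Suc s. \<bar>c j\<bar>)" using that by (intro member_le_sum) auto
    then show ?thesis unfolding C_def by linarith
  qed
  define k where "k j x = (if 0 < x \<and> x < 1 then poly (p j) x else 0) / C" for j x
  have "(k j has_real_derivative k (Suc j) x) (at x)" if "j \<le> s" for j x
    unfolding k_def
    using p0[of j] p0[of "Suc j"] that
    by (intro DERIV_cdivide DERIV_zero_outside_interval) (auto simp: p_def)
  moreover have "\<bar>k j x\<bar> \<le> 1" if "j \<le> Suc s" for j x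
    using c[of x j] cC[OF that] C by (auto simp: k_def)
  moreover have "k j x = 0" if "x \<notin> {0<..<1}" for j x
    using that by (auto simp: k_def)
  moreover have "0 \<le> k 0 x" for x
    using C by (auto simp: k_def p_def q intro!: zero_le_power)
  moreover have "(3/16) ^ N / C \<le> k 0 x" if "x \<in> {1/4..3/4}" for x
  proof -
    \<comment> \<open>On the middle half, \<open>x (1 - x)\<close> is smallest at the two ends.\<close>
    have "0 \<le> (x - 1/4) * (3/4 - x)" using that by (intro mult_nonneg_nonneg) auto
    then have "3/16 \<le> x * (1 - x)" by (simp add: field_simps)
    then have "(3/16) ^ N \<le> (x * (1 - x)) ^ N" by (intro power_mono) auto
    then show ?thesis using that C by (auto simp: k_def p_def q divide_right_mono)
  qed
  moreover have "0 < (3/16) ^ N / C" using C by simp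
  ultimately show ?thesis unfolding smooth_bump_def by blast
qed

text \<open>
  The cells of side \<open>1/m\<close>, each named by \<open>m\<close> times its lower corner.
\<close>

definition grid :: "nat \<Rightarrow> nat \<Rightarrow> (nat \<Rightarrow> nat) set" where
  "grid t m = {..<t} \<rightarrow>\<^sub>E {..<m}"

lemma finite_grid: "finite (grid t m)"
  unfolding grid_def by (intro finite_PiE) auto

lemma card_grid: "card (grid t m) = m ^ t"
  unfolding grid_def by (simp add: card_PiE)

text \<open>
  A mixed partial derivative, of multi-index \<open>\<alpha>\<close>, of the product bump on the cell \<open>u\<close>, up to the
  factor that the chain rule contributes, a power of \<open>m\<close>.
\<close>

definition cell_bump ::
    "(nat \<Rightarrow> real \<Rightarrow> real) \<Rightarrow> nat \<Rightarrow> nat \<Rightarrow> (nat \<Rightarrow> nat) \<Rightarrow> (nat \<Rightarrow> nat) \<Rightarrow> (nat \<Rightarrow> real) \<Rightarrow> real" where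
  "cell_bump k t m \<alpha> u x = (\<Prod>j<t. k (\<alpha> j) (real m * x j - real (u j)))"

lemma abs_smooth_bump_le: "smooth_bump s \<kappa> k \<Longrightarrow> j \<le> s \<Longrightarrow> \<bar>k j x\<bar> \<le> 1"
  by (simp add: smooth_bump_def)

lemma multi_order_ge: "j < t \<Longrightarrow> \<alpha> j \<le> multi_order t \<alpha>"
  unfolding multi_order_def by (intro member_le_sum) auto

lemma cell_bump_support:
  assumes "smooth_bump s \<kappa> k" "multi_order t \<alpha> \<le> s" "cell_bump k t m \<alpha> u x \<noteq> 0" "j < t"
  shows "real (u j) < real m * x j" "real m * x j < real (u j) + 1"
proof -
  have "k (\<alpha> j) (real m * x j - real (u j)) \<noteq> 0"
    using assms(3,4) by (auto simp: cell_bump_def)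
  then have "real m * x j - real (u j) \<in> {0<..<1}"
    using assms(1,2) multi_order_ge[OF assms(4), of \<alpha>] unfolding smooth_bump_def by (meson le_SucI le_trans)
  then show "real (u j) < real m * x j" "real m * x j < real (u j) + 1" by auto
qed

lemma cell_bump_disjoint:
  assumes "smooth_bump s \<kappa> k" "multi_order t \<alpha> \<le> s" "u \<in> grid t m" "v \<in> grid t m"
    and "cell_bump k t m \<alpha> u x \<noteq> 0" "cell_bump k t m \<alpha> v x \<noteq> 0"
  shows "u = v"
proof (rule PiE_ext)
  show "u \<in> {..<t} \<rightarrow>\<^sub>E {..<m}" "v \<in> {..<t} \<rightarrow>\<^sub>E {..<m}" using assms(3,4) by (auto simp: grid_def)
  fix j assume "j \<in> {..<t}"
  then have "j < t" by simp
  from cell_bump_support[OF assms(1,2,5) this] cell_bump_support[OF assms(1,2,6) this]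
  show "u j = v j" by linarith
qed

lemma abs_cell_bump_le:
  assumes "smooth_bump s \<kappa> k" "multi_order t \<alpha> \<le> s"
  shows "\<bar>cell_bump k t m \<alpha> u x\<bar> \<le> 1"
  unfolding cell_bump_def abs_prod
  using abs_smooth_bump_le[OF assms(1) order_trans[OF multi_order_ge assms(2)]]
  by (intro prod_le_1) auto

lemma smooth_bump_lipschitz:
  assumes "smooth_bump s \<kappa> k" "j \<le> s"
  shows "\<bar>k j x - k j y\<bar> \<le> \<bar>x - y\<bar>"
proof -
  have "norm (k j x - k j y) \<le> 1 * norm (x - y)"
    using assms by (intro field_differentiable_bound[of UNIV "k j" "k (Suc j)"]) (auto simp: smooth_bump_def)
  then show ?thesis by simp
qed

lemma cell_bump_lipschitz:
  assumes k: "smooth_bump s \<kappa> k" and \<alpha>: "multi_order t \<alpha> \<le> s"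
  shows "\<bar>cell_bump k t m \<alpha> u x - cell_bump k t m \<alpha> u y\<bar> \<le> real t * (real m * sup_dist t x y)"
proof -
  have j: "\<alpha> j \<le> s" if "j < t" for j using multi_order_ge[OF that, of \<alpha>] \<alpha> by simp
  have "norm (cell_bump k t m \<alpha> u x - cell_bump k t m \<alpha> u y) \<le>
      (\<Sum>j<t. norm (k (\<alpha> j) (real m * x j - real (u j)) - k (\<alpha> j) (real m * y j - real (u j))))"
    unfolding cell_bump_def using abs_smooth_bump_le[OF k j] by (intro norm_prod_diff) auto
  also have "\<dots> \<le> (\<Sum>j<t. real m * sup_dist t x y)"
  proof (rule sum_mono)
    fix j assume "j \<in> {..<t}"
    then have "j < t" by simp
    have "norm (k (\<alpha> j) (real m * x j - real (u j)) - k (\<alpha> j) (real m * y j - real (u j)))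
        \<le> \<bar>(real m * x j - real (u j)) - (real m * y j - real (u j))\<bar>"
      using smooth_bump_lipschitz[OF k j[OF \<open>j < t\<close>]] by (simp only: real_norm_def)
    also have "\<dots> = real m * \<bar>x j - y j\<bar>"
      by (simp add: abs_mult right_diff_distrib[symmetric])
    also have "\<dots> \<le> real m * sup_dist t x y"
      using sup_dist_ge[OF \<open>j < t\<close>] by (intro mult_left_mono) auto
    finally show "norm (k (\<alpha> j) (real m * x j - real (u j)) - k (\<alpha> j) (real m * y j - real (u j)))
        \<le> real m * sup_dist t x y" .
  qed
  finally show ?thesis by simp
qed

lemma sum_disjoint_cases:
  assumes "finite W" "\<And>u v. u \<in> W \<Longrightarrow> v \<in> W \<Longrightarrow> f u \<noteq> 0 \<Longrightarrow> f v \<noteq> 0 \<Longrightarrow> u = v"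
  obtains (zero) "\<And>v. v \<in> W \<Longrightarrow> f v = 0" "sum f W = 0"
  | (single) u where "u \<in> W" "sum f W = f u" "f u \<noteq> 0" "\<And>v. v \<in> W \<Longrightarrow> v \<noteq> u \<Longrightarrow> f v = 0"
proof (cases "\<forall>v\<in>W. f v = 0")
  case False
  then obtain u where u: "u \<in> W" "f u \<noteq> 0" by auto
  then have z: "f v = 0" if "v \<in> W" "v \<noteq> u" for v using assms(2) that by blast
  have "sum f W = f u + sum f (W - {u})" using u assms(1) by (simp add: sum.remove)
  also have "sum f (W - {u}) = 0" using z by (intro sum.neutral) auto
  finally show thesis using u z single by simp
qed (use zero in auto)

text \<open>
  At each of two points at most one summand is nonzero, so at most two summands change between
  the points. The bound on the change therefore does not grow with the number of summands.
\<close>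

lemma sum_disjoint_diff_le:
  fixes f g :: "'a \<Rightarrow> real"
  assumes "finite W" "0 \<le> L"
    and "\<And>u v. u \<in> W \<Longrightarrow> v \<in> W \<Longrightarrow> f u \<noteq> 0 \<Longrightarrow> f v \<noteq> 0 \<Longrightarrow> u = v"
    and "\<And>u v. u \<in> W \<Longrightarrow> v \<in> W \<Longrightarrow> g u \<noteq> 0 \<Longrightarrow> g v \<noteq> 0 \<Longrightarrow> u = v"
    and L: "\<And>u. u \<in> W \<Longrightarrow> \<bar>f u - g u\<bar> \<le> L"
  shows "\<bar>sum f W - sum g W\<bar> \<le> 2 * L"
proof (rule sum_disjoint_cases[OF assms(1,3)])
  assume f: "\<And>v. v \<in> W \<Longrightarrow> f v = 0" "sum f W = 0"
  show ?thesis
  proof (rule sum_disjoint_cases[OF assms(1,4)])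
    fix v assume v: "v \<in> W" "sum g W = g v"
    then show ?thesis using f(1)[OF v(1)] f(2) L[OF v(1)] by simp
  qed (use f \<open>0 \<le> L\<close> in auto)
next
  fix u assume u: "u \<in> W" "sum f W = f u" "\<And>v. v \<in> W \<Longrightarrow> v \<noteq> u \<Longrightarrow> f v = 0"
  show ?thesis
  proof (rule sum_disjoint_cases[OF assms(1,4)])
    assume g: "\<And>v. v \<in> W \<Longrightarrow> g v = 0" "sum g W = 0"
    then show ?thesis using u g(1)[OF u(1)] L[OF u(1)] by simp
  next
    fix v assume v: "v \<in> W" "sum g W = g v" "\<And>u. u \<in> W \<Longrightarrow> u \<noteq> v \<Longrightarrow> g u = 0"
    show ?thesis
    proof (cases "u = v")
      case True
      then show ?thesis using u v L[OF u(1)] by simp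
    next
      case False
      then have "f v = 0" "g u = 0" using u v by auto
      then show ?thesis using u v L[OF u(1)] L[OF v(1)] by simp
    qed
  qed auto
qed auto

definition bump_sum ::
    "(nat \<Rightarrow> real \<Rightarrow> real) \<Rightarrow> nat \<Rightarrow> nat \<Rightarrow> (nat \<Rightarrow> nat) set \<Rightarrow> (nat \<Rightarrow> nat) \<Rightarrow> (nat \<Rightarrow> real) \<Rightarrow> real" where
  "bump_sum k t m W \<alpha> x = (\<Sum>u\<in>W. cell_bump k t m \<alpha> u x)"

lemma abs_bump_sum_le:
  assumes "smooth_bump s \<kappa> k" "multi_order t \<alpha> \<le> s" "W \<subseteq> grid t m"
  shows "\<bar>bump_sum k t m W \<alpha> x\<bar> \<le> 1"
  unfolding bump_sum_def
proof (rule sum_disjoint_cases[of W "\<lambda>u. cell_bump k t m \<alpha> u x"])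
  show "finite W" using assms(3) finite_grid finite_subset by blast
  fix u v assume "u \<in> W" "v \<in> W" "cell_bump k t m \<alpha> u x \<noteq> 0" "cell_bump k t m \<alpha> v x \<noteq> 0"
  then show "u = v" using cell_bump_disjoint[OF assms(1,2)] assms(3) by blast
qed (use abs_cell_bump_le[OF assms(1,2)] in simp_all)

lemma bump_sum_lipschitz:
  assumes "smooth_bump s \<kappa> k" "multi_order t \<alpha> \<le> s" "W \<subseteq> grid t m" "0 < t"
  shows "\<bar>bump_sum k t m W \<alpha> x - bump_sum k t m W \<alpha> y\<bar> \<le> 2 * (real t * (real m * sup_dist t x y))"
  unfolding bump_sum_def
proof (rule sum_disjoint_diff_le)
  show "finite W" using assms(3) finite_grid finite_subset by blast
  have disj: "u = v" if "u \<in> W" "v \<in> W" "cell_bump k t m \<alpha> u z \<noteq> 0" "cell_bump k t m \<alpha> v z \<noteq> 0" for u v z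
    using that cell_bump_disjoint[OF assms(1,2)] assms(3) by blast
  show "u = v" if "u \<in> W" "v \<in> W" "cell_bump k t m \<alpha> u x \<noteq> 0" "cell_bump k t m \<alpha> v x \<noteq> 0" for u v
    using disj that .
  show "u = v" if "u \<in> W" "v \<in> W" "cell_bump k t m \<alpha> u y \<noteq> 0" "cell_bump k t m \<alpha> v y \<noteq> 0" for u v
    using disj that .
  show "0 \<le> real t * (real m * sup_dist t x y)"
    using sup_dist_nonneg[OF \<open>0 < t\<close>] by simp
qed (auto intro: cell_bump_lipschitz[OF assms(1,2)])

lemma cell_bump_has_derivative:
  assumes k: "smooth_bump s \<kappa> k" and "multi_order t \<alpha> \<le> s" and "i < t"
  shows "((\<lambda>y. cell_bump k t m \<alpha> u (x(i := y))) has_real_derivative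
    real m * cell_bump k t m (\<alpha>(i := Suc (\<alpha> i))) u x) (at (x i))"
proof -
  define R where "R = (\<Prod>j\<in>{..<t} - {i}. k (\<alpha> j) (real m * x j - real (u j)))"
  have \<alpha>i: "\<alpha> i \<le> s" using multi_order_ge[OF \<open>i < t\<close>, of \<alpha>] assms(2) by simp
  have split: "cell_bump k t m \<alpha>' u (x(i := y)) = k (\<alpha>' i) (real m * y - real (u i)) * R"
    if "\<And>j. j \<noteq> i \<Longrightarrow> \<alpha>' j = \<alpha> j" for \<alpha>' y
    unfolding cell_bump_def R_def using that \<open>i < t\<close>
    by (subst prod.remove[of _ i]) (auto intro!: prod.cong)
  have "(k (\<alpha> i) has_real_derivative k (Suc (\<alpha> i)) z) (at z)" for z
    using k \<alpha>i by (auto simp: smooth_bump_def)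
  then have "((\<lambda>y. k (\<alpha> i) (real m * y - real (u i)) * R) has_real_derivative
      k (Suc (\<alpha> i)) (real m * x i - real (u i)) * real m * R) (at (x i))"
    by (intro DERIV_cmult_right DERIV_chain2[where f = "k (\<alpha> i)"]) (auto intro!: derivative_eq_intros)
  also have "(\<lambda>y. k (\<alpha> i) (real m * y - real (u i)) * R) = (\<lambda>y. cell_bump k t m \<alpha> u (x(i := y)))"
    using split[of \<alpha>] by simp
  also have "k (Suc (\<alpha> i)) (real m * x i - real (u i)) * real m * R =
      real m * cell_bump k t m (\<alpha>(i := Suc (\<alpha> i))) u x"
    using split[of "\<alpha>(i := Suc (\<alpha> i))" "x i"] by simp
  finally show ?thesis .
qed

text \<open>
  The derivatives of order \<open>j\<close> gain a factor \<open>m ^ j\<close>, which \<open>m powr (-\<beta>)\<close> absorbs for all \<open>j < \<beta>\<close>.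
  At the top order \<open>s\<close>, with \<open>\<gamma> = \<beta> - s\<close> and \<open>r\<close> equal to \<open>m\<close> times the distance of the points, the
  increments of the sum of bumps are bounded both by a multiple of \<open>r\<close> and by a constant, hence
  by a multiple of \<open>r powr \<gamma>\<close>; the remaining factor \<open>m powr (-\<gamma>)\<close> turns this into the Hoelder bound.
\<close>

lemma bump_sum_in_holder_ball:
  assumes \<beta>: "0 < \<beta>" and k: "smooth_bump (strict_floor \<beta>) \<kappa> k"
    and W: "W \<subseteq> grid t m" and t: "0 < t" and m: "1 \<le> m"
  shows "(\<lambda>x. real m powr (-\<beta>) * bump_sum k t m W (\<lambda>_. 0) x)
    \<in> holder_ball 0 1 t \<beta> (2 * real t * real (holder_terms t \<beta>))"
proof -
  define s where "s = strict_floor \<beta>"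
  define \<gamma> where "\<gamma> = \<beta> - real s"
  note k = k[folded s_def]
  have \<gamma>: "0 < \<gamma>" "\<gamma> \<le> 1" and s: "real s < \<beta>"
    using strict_floor_bounds[OF \<beta>] by (auto simp: \<gamma>_def s_def)
  define D where "D \<alpha> x = real m powr (real (multi_order t \<alpha>) - \<beta>) * bump_sum k t m W \<alpha> x" for \<alpha> x
  have "derivative_table 0 1 t s D"
    unfolding derivative_table_def
  proof (intro allI impI, elim conjE)
    fix \<alpha> i x assume *: "multi_order t \<alpha> < s" "i < t"
    have pw: "real m powr (real (Suc (multi_order t \<alpha>)) - \<beta>) =
        real m powr (real (multi_order t \<alpha>) - \<beta>) * real m"
      using m powr_add[of "real m" "real (multi_order t \<alpha>) - \<beta>" 1] by (simp add: algebra_simps)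
    have "((\<lambda>y. D \<alpha> (x(i := y))) has_real_derivative D (\<alpha>(i := Suc (\<alpha> i))) x) (at (x i) within {0..1})"
      unfolding D_def bump_sum_def multi_order_Suc[OF \<open>i < t\<close>] pw mult.assoc sum_distrib_left[of "real m"]
      using * by (intro DERIV_cmult DERIV_sum cell_bump_has_derivative[OF k, THEN has_field_derivative_at_within]) auto
    then show "((\<lambda>y. D \<alpha> (x(i := y))) has_vector_derivative D (\<alpha>(i := Suc (\<alpha> i))) x)
        (at (x i) within {0..1})"
      by (simp add: has_real_derivative_iff_has_vector_derivative)
  qed
  moreover have "\<bar>D \<alpha> x\<bar> \<le> 2 * real t" if "multi_order t \<alpha> \<le> s" for \<alpha> x
  proof -
    have "real m powr (real (multi_order t \<alpha>) - \<beta>) \<le> real m powr 0"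
      using that s m by (intro powr_mono) auto
    then have "\<bar>D \<alpha> x\<bar> \<le> 1 * 1"
      unfolding D_def abs_mult using abs_bump_sum_le[OF k that W] m by (intro mult_mono) auto
    then show ?thesis using t by simp
  qed
  moreover have "\<bar>D \<alpha> x - D \<alpha> y\<bar> \<le> 2 * real t * sup_dist t x y powr \<gamma>"
    if \<alpha>: "multi_order t \<alpha> = s" for \<alpha> x y
  proof -
    define r where "r = real m * sup_dist t x y"
    have r: "0 \<le> r" using sup_dist_nonneg[OF t] by (simp add: r_def)
    have 1: "\<bar>bump_sum k t m W \<alpha> x - bump_sum k t m W \<alpha> y\<bar> \<le> 2 * (real t * r)"
      unfolding r_def using bump_sum_lipschitz[OF k _ W t] \<alpha> by simp
    have 2: "\<bar>bump_sum k t m W \<alpha> x - bump_sum k t m W \<alpha> y\<bar> \<le> 2"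
      using abs_bump_sum_le[OF k _ W, of \<alpha> x] abs_bump_sum_le[OF k _ W, of \<alpha> y] \<alpha> by linarith
    have "\<bar>bump_sum k t m W \<alpha> x - bump_sum k t m W \<alpha> y\<bar> \<le> 2 * real t * r powr \<gamma>"
    proof (cases "r \<le> 1")
      case True
      have "2 * (real t * r) \<le> 2 * real t * r powr \<gamma>"
        using le_powr_unit_exponent[OF r True \<gamma>] t by simp
      then show ?thesis using 1 by linarith
    next
      case False
      then have "1 \<le> r powr \<gamma>" using \<gamma> by (intro ge_one_powr_ge_zero) auto
      then have "2 * 1 \<le> (2 * real t) * r powr \<gamma>" using t by (intro mult_mono) auto
      then show ?thesis using 2 by linarith
    qed
    then have "real m powr (- \<gamma>) * \<bar>bump_sum k t m W \<alpha> x - bump_sum k t m W \<alpha> y\<bar>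
        \<le> real m powr (- \<gamma>) * (2 * real t * r powr \<gamma>)"
      by (intro mult_left_mono) auto
    also have "\<dots> = 2 * real t * sup_dist t x y powr \<gamma>"
      using m sup_dist_nonneg[OF t, of x y] by (simp add: r_def powr_mult powr_minus field_simps)
    also have "real m powr (- \<gamma>) * \<bar>bump_sum k t m W \<alpha> x - bump_sum k t m W \<alpha> y\<bar> = \<bar>D \<alpha> x - D \<alpha> y\<bar>"
      by (simp add: D_def \<alpha> \<gamma>_def right_diff_distrib[symmetric] abs_mult)
    finally show ?thesis .
  qed
  ultimately have "D (\<lambda>_. 0) \<in> holder_ball 0 1 t \<beta> (2 * real t * real (holder_terms t \<beta>))"
    using \<beta> unfolding s_def \<gamma>_def by (intro holder_ballI[where C = "2 * real t"]) auto
  then show ?thesis by (simp add: D_def[abs_def] multi_order_def)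
qed

section \<open>Perturbing a single layer of a composition\<close>

text \<open>
  A single coordinate \<open>c\<close> becomes the first of the \<open>t\<close> selected arguments by exchanging 0 and \<open>c\<close>.
\<close>

lemma coordinate_in_sparse_holder:
  assumes "0 < t" "t \<le> r" "c < r" "0 < \<beta>" "real (holder_terms t \<beta>) \<le> K"
  shows "(\<lambda>x. x c) \<in> sparse_holder 0 1 r t \<beta> K"
proof -
  define \<sigma> where "\<sigma> = Transposition.transpose 0 c"
  have "inj_on \<sigma> {..<t}" by (auto simp: \<sigma>_def inj_on_def Transposition.transpose_def split: if_splits)
  moreover have "\<sigma> ` {..<t} \<subseteq> {..<r}"
    using assms by (auto simp: \<sigma>_def Transposition.transpose_def)
  moreover have "(\<lambda>y. y 0) \<in> holder_ball 0 1 t \<beta> K"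
    using assms coordinate_in_holder_ball holder_ball_mono by blast
  moreover have "x c = (\<lambda>k\<in>{..<t}. x (\<sigma> k)) 0" for x :: "nat \<Rightarrow> real"
    using assms by (simp add: \<sigma>_def)
  ultimately show ?thesis unfolding sparse_holder_def by blast
qed

text \<open>
  For \<open>\<beta> > 1\<close> the power is 1, and \<open>x 0 powr 1\<close> coincides with the coordinate \<open>x 0\<close> only where it is
  nonnegative, in particular on the cube.
\<close>

lemma power_in_sparse_holder:
  assumes "0 < t" "t \<le> r" "0 < \<beta>" "real (holder_terms t \<beta>) \<le> K"
  shows "(\<lambda>x. x 0 powr min \<beta> 1) \<in> sparse_holder 0 1 r t \<beta> K"
proof -
  define h where "h y = (if \<beta> \<le> 1 then y 0 powr \<beta> else y 0)" for y :: "nat \<Rightarrow> real"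
  have "h \<in> holder_ball 0 1 t \<beta> K"
    using assms coordinate_in_holder_ball[of t \<beta>] power_in_holder_ball[of t \<beta>] holder_ball_mono
    by (cases "\<beta> \<le> 1") (auto simp: h_def[abs_def])
  moreover have "x 0 powr min \<beta> 1 = h (\<lambda>k\<in>{..<t}. x k)" if "x \<in> cube 0 1 r" for x
    using assms cube_coord[OF that, of 0] by (auto simp: h_def)
  ultimately show ?thesis
    unfolding sparse_holder_def using assms by (auto intro!: exI[of _ "\<lambda>k. k"] exI[of _ h])
qed

lemma restrict_cube:
  assumes "x \<in> cube a b r" "t \<le> r"
  shows "(\<lambda>k\<in>{..<t}. x k) \<in> cube a b t"
  using assms by (auto simp: cube_def PiE_iff)

text \<open>
  All intermediate cubes are unit cubes. Before the layer \<open>l\<close> every component is a coordinate,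
  so that the first \<open>t l\<close> coordinates survive; at the layer \<open>l\<close> all components equal \<open>\<phi>\<close>; afterwards
  all components are the same power of the first coordinate, and the exponents multiply up.
\<close>

lemma single_layer_in_composition_class:
  fixes d t :: "nat \<Rightarrow> nat"
  assumes d: "d (Suc q) = 1" and t: "\<And>i. i \<le> q \<Longrightarrow> 1 \<le> t i \<and> t i \<le> d i"
    and l: "l \<le> q" and t_l: "\<And>i. i < l \<Longrightarrow> t l \<le> d i"
    and \<beta>: "\<And>i. i \<le> q \<Longrightarrow> 0 < \<beta> i"
    and K: "1 \<le> K" "\<And>i. i \<le> q \<Longrightarrow> real (holder_terms (t i) (\<beta> i)) \<le> K"
    and \<phi>: "\<phi> \<in> holder_ball 0 1 (t l) (\<beta> l) K" "\<And>y. y \<in> cube 0 1 (t l) \<Longrightarrow> \<phi> y \<in> {0..1}"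
    and f: "\<And>x. x \<in> cube 0 1 (d 0) \<Longrightarrow>
      f x = \<phi> (\<lambda>k\<in>{..<t l}. x k) powr (\<Prod>i\<in>{l<..q}. min (\<beta> i) 1)"
  shows "f \<in> composition_class q d t \<beta> K"
proof -
  \<comment> \<open>If the dimension grows before layer \<open>l\<close>, the excess components repeat the last coordinate.\<close>
  define g where "g i x = (\<lambda>j\<in>{..<d (Suc i)}. if i < l then x (min j (d i - 1))
      else if i = l then \<phi> (\<lambda>k\<in>{..<t l}. x k) else x 0 powr min (\<beta> i) 1)" for i x
  have d_pos: "0 < d i" if "i \<le> Suc q" for i
    using that t[of i] d by (cases "i = Suc q") auto
  have g_cube: "g i x \<in> cube 0 1 (d (Suc i))" if "i \<le> q" "x \<in> cube 0 1 (d i)" for i x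
  proof -
    have "x (min j (d i - 1)) \<in> {0..1}" for j
      using d_pos[of i] that by (intro cube_coord[OF that(2)]) auto
    moreover have "\<phi> (\<lambda>k\<in>{..<t l}. x k) \<in> {0..1}" if "i = l"
      using that t[OF l] \<open>x \<in> cube 0 1 (d i)\<close> by (intro \<phi> restrict_cube) auto
    moreover have "x 0 powr min (\<beta> i) 1 \<in> {0..1}"
      using cube_coord[OF that(2), of 0] d_pos[of i] that(1) \<beta>[of i] by (auto intro!: powr_le1)
    ultimately show ?thesis by (auto simp: cube_def g_def)
  qed
  have g_holder: "(\<lambda>x. g i x j) \<in> sparse_holder 0 1 (d i) (t i) (\<beta> i) K"
    if i: "i \<le> q" and j: "j < d (Suc i)" for i j
  proof -
    have ti: "0 < t i" "t i \<le> d i" using t[OF i] by auto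
    consider "i < l" | "i = l" | "l < i" by linarith
    then show ?thesis
    proof cases
      case 1
      then have "(\<lambda>x. g i x j) = (\<lambda>x. x (min j (d i - 1)))" using j by (simp add: g_def)
      then show ?thesis
        using ti \<beta>[OF i] K(2)[OF i] by (simp only:) (intro coordinate_in_sparse_holder, auto)
    next
      case 2
      then have "(\<lambda>x. g i x j) = (\<lambda>x. \<phi> (\<lambda>k\<in>{..<t i}. x k))" using j by (simp add: g_def)
      then show ?thesis
        unfolding sparse_holder_def using \<phi>(1) ti 2 by (auto intro!: exI[of _ "\<lambda>k. k"] exI[of _ \<phi>])
    next
      case 3
      then have "(\<lambda>x. g i x j) = (\<lambda>x. x 0 powr min (\<beta> i) 1)" using j by (simp add: g_def)
      then show ?thesis
        using ti \<beta>[OF i] K(2)[OF i] by (simp only:) (intro power_in_sparse_holder, auto)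
    qed
  qed
  have f_fold: "f x = fold g [0..<Suc q] x 0" if x: "x \<in> cube 0 1 (d 0)" for x
  proof -
    define F where "F i = fold g [0..<i] x" for i
    have F_Suc: "F (Suc i) = g i (F i)" for i by (simp add: F_def)
    have early: "\<forall>k<t l. F i k = x k" if "i \<le> l" for i
      using that
    proof (induction i)
      case 0
      then show ?case by (simp add: F_def)
    next
      case (Suc i)
      have "t l \<le> d i" "t l \<le> d (Suc i)"
        using Suc.prems t_l[of i] t_l[of "Suc i"] t[OF l] by (cases "Suc i = l"; auto)+
      then show ?case using Suc by (auto simp: F_Suc g_def)
    qed
    define y where "y = (\<lambda>k\<in>{..<t l}. x k)"
    have "t l \<le> d 0" using t_l[of 0] t[OF l] by (cases "l = 0") auto
    then have y: "0 \<le> \<phi> y" using \<phi>(2)[OF restrict_cube[OF x]] by (simp add: y_def)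
    have late: "F (Suc (l + i)) 0 = \<phi> y powr (\<Prod>i\<in>{l<..l + i}. min (\<beta> i) 1)" if "l + i \<le> q" for i
      using that
    proof (induction i)
      case 0
      have "(\<lambda>k\<in>{..<t l}. F l k) = y" using early[of l] by (auto simp: y_def restrict_def)
      then show ?case using d_pos[of "Suc l"] l y by (simp add: F_Suc g_def)
    next
      case (Suc i)
      have "{l<..l + Suc i} = insert (l + Suc i) {l<..l + i}" by auto
      then show ?case
        using Suc d_pos[of "Suc (Suc (l + i))"] by (simp add: F_Suc[of "Suc (l + i)"] g_def powr_powr mult.commute)
    qed
    show ?thesis using late[of "q - l"] l by (simp add: f[OF x] F_def y_def del: upt_Suc)
  qed
  show ?thesis
    unfolding composition_class_def
  proof (rule CollectI, rule exI[of _ "\<lambda>_. 0"], rule exI[of _ "\<lambda>_. 1"], rule exI[of _ g], intro conjI)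
    show "\<forall>i\<le>q. g i \<in> cube 0 1 (d i) \<rightarrow> cube 0 1 (d (Suc i))" using g_cube by blast
    show "\<forall>i\<le>q. \<forall>j<d (Suc i). (\<lambda>x. g i x j) \<in> sparse_holder 0 1 (d i) (t i) (\<beta> i) K"
      using g_holder by blast
    show "\<forall>x\<in>cube 0 1 (d 0). f x = fold g [0..<Suc q] x 0" using f_fold by blast
  qed (use K(1) in auto)
qed

section \<open>Two Gaussian shifts\<close>

lemma sets_std_normal [measurable_cong, simp]: "sets std_normal = sets borel"
  by (simp add: std_normal_def)

lemma space_std_normal [simp]: "space std_normal = UNIV"
  by (simp add: std_normal_def)

lemma prob_space_std_normal: "prob_space std_normal"
  unfolding std_normal_def by (rule prob_space_normal_density) simp

text \<open>
  Translating a standard normal variable by \<open>\<delta>\<close> multiplies its density by the likelihood ratio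
  \<open>exp (\<delta> x - \<delta>\<^sup>2 / 2)\<close>.
\<close>

lemma std_normal_shift:
  assumes [measurable]: "g \<in> borel_measurable borel"
  shows "(\<integral>\<^sup>+x. g (\<delta> + x) \<partial>std_normal) = (\<integral>\<^sup>+x. ennreal (exp (\<delta> * x - \<delta>\<^sup>2 / 2)) * g x \<partial>std_normal)"
proof -
  have eq: "std_normal_density (- \<delta> + x) = std_normal_density x * exp (\<delta> * x - \<delta>\<^sup>2 / 2)" for x
    by (simp add: std_normal_density_def exp_add[symmetric] power2_eq_square field_simps)
  have "(\<integral>\<^sup>+x. g (\<delta> + x) \<partial>std_normal) = (\<integral>\<^sup>+x. ennreal (std_normal_density x) * g (\<delta> + x) \<partial>lborel)"
    unfolding std_normal_def by (intro nn_integral_density) auto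
  also have "\<dots> = (\<integral>\<^sup>+x. ennreal (std_normal_density (- \<delta> + x)) * g x \<partial>lborel)"
    by (subst nn_integral_real_affine[where c = 1 and t = "- \<delta>"]) auto
  also have "\<dots> = (\<integral>\<^sup>+x. ennreal (std_normal_density x) * (ennreal (exp (\<delta> * x - \<delta>\<^sup>2 / 2)) * g x) \<partial>lborel)"
    unfolding eq by (simp add: ennreal_mult mult.assoc)
  also have "\<dots> = (\<integral>\<^sup>+x. ennreal (exp (\<delta> * x - \<delta>\<^sup>2 / 2)) * g x \<partial>std_normal)"
    unfolding std_normal_def by (intro nn_integral_density[symmetric]) auto
  finally show ?thesis .
qed

text \<open>
  The law of the translated noise vector and the law weighted by the product of the likelihood
  ratios are both the product of the translated one-dimensional laws; it suffices to compare them
  with it on rectangles.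
\<close>

lemma gaussian_product_shift:
  fixes \<delta> :: "'i \<Rightarrow> real"
  assumes I: "finite I" and [measurable]: "g \<in> borel_measurable (Pi\<^sub>M I (\<lambda>_. borel))"
  shows "(\<integral>\<^sup>+\<epsilon>. g (\<lambda>i\<in>I. \<delta> i + \<epsilon> i) \<partial>Pi\<^sub>M I (\<lambda>_. std_normal)) =
    (\<integral>\<^sup>+\<epsilon>. ennreal (exp (\<Sum>i\<in>I. \<delta> i * \<epsilon> i - (\<delta> i)\<^sup>2 / 2)) * g \<epsilon> \<partial>Pi\<^sub>M I (\<lambda>_. std_normal))"
proof -
  let ?N = "Pi\<^sub>M I (\<lambda>_. std_normal)" and ?B = "Pi\<^sub>M I (\<lambda>_. borel :: real measure)"
  define Q where "Q i = distr std_normal borel (\<lambda>x. \<delta> i + x)" for i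
  have [measurable_cong, simp]: "sets (Q i) = sets borel" for i by (simp add: Q_def)
  have Q_prob: "prob_space (Q i)" for i
    unfolding Q_def by (intro prob_space.prob_space_distr prob_space_std_normal) simp
  interpret N: prob_space std_normal by (rule prob_space_std_normal)
  interpret N: product_sigma_finite "\<lambda>_::'i. std_normal" ..
  interpret Q: product_sigma_finite Q
    using Q_prob by (auto simp: product_sigma_finite_def intro: prob_space_imp_sigma_finite)
  have Q_shift: "emeasure (Q i) A = (\<integral>\<^sup>+x. ennreal (exp (\<delta> i * x - (\<delta> i)\<^sup>2 / 2)) * indicator A x \<partial>std_normal)"
    if [measurable]: "A \<in> sets borel" for i A
  proof -
    have "emeasure (Q i) A = (\<integral>\<^sup>+x. indicator A (\<delta> i + x) \<partial>std_normal)"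
      unfolding Q_def by (simp add: nn_integral_distr flip: nn_integral_indicator)
    then show ?thesis by (simp add: std_normal_shift)
  qed
  have [simp]: "sets (Pi\<^sub>M I Q) = sets ?B" by (intro sets_PiM_cong) auto
  have sets_N [simp, measurable_cong]: "sets ?N = sets ?B" by (intro sets_PiM_cong) auto
  have "distr ?N ?B (\<lambda>\<epsilon>. \<lambda>i\<in>I. \<delta> i + \<epsilon> i) = Pi\<^sub>M I Q"
  proof (rule Q.PiM_eqI[OF I])
    fix A assume A: "\<And>i. i \<in> I \<Longrightarrow> A i \<in> sets (Q i)"
    have "emeasure (distr ?N ?B (\<lambda>\<epsilon>. \<lambda>i\<in>I. \<delta> i + \<epsilon> i)) (Pi\<^sub>E I A) =
        emeasure ?N ((\<lambda>\<epsilon>. \<lambda>i\<in>I. \<delta> i + \<epsilon> i) -` Pi\<^sub>E I A \<inter> space ?N)"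
      using A I by (intro emeasure_distr sets_PiM_I_finite) (auto intro!: measurable_restrict)
    also have "(\<lambda>\<epsilon>. \<lambda>i\<in>I. \<delta> i + \<epsilon> i) -` Pi\<^sub>E I A \<inter> space ?N = Pi\<^sub>E I (\<lambda>i. (\<lambda>x. \<delta> i + x) -` A i)"
      by (auto simp: space_PiM PiE_iff)
    also have "emeasure ?N \<dots> = (\<Prod>i\<in>I. emeasure std_normal ((\<lambda>x. \<delta> i + x) -` A i))"
      using A I by (intro N.emeasure_PiM) (auto intro!: measurable_sets_borel[of _ borel])
    also have "\<dots> = (\<Prod>i\<in>I. emeasure (Q i) (A i))"
      using A by (intro prod.cong) (auto simp: Q_def emeasure_distr)
    finally show "emeasure (distr ?N ?B (\<lambda>\<epsilon>. \<lambda>i\<in>I. \<delta> i + \<epsilon> i)) (Pi\<^sub>E I A) = (\<Prod>i\<in>I. emeasure (Q i) (A i))" .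
  qed simp
  moreover have "density ?N (\<lambda>\<epsilon>. ennreal (exp (\<Sum>i\<in>I. \<delta> i * \<epsilon> i - (\<delta> i)\<^sup>2 / 2))) = Pi\<^sub>M I Q"
  proof (rule Q.PiM_eqI[OF I])
    fix A assume "\<And>i. i \<in> I \<Longrightarrow> A i \<in> sets (Q i)"
    then have A: "\<And>i. i \<in> I \<Longrightarrow> A i \<in> sets borel" by simp
    have "emeasure (density ?N (\<lambda>\<epsilon>. ennreal (exp (\<Sum>i\<in>I. \<delta> i * \<epsilon> i - (\<delta> i)\<^sup>2 / 2)))) (Pi\<^sub>E I A) =
        (\<integral>\<^sup>+\<epsilon>. ennreal (exp (\<Sum>i\<in>I. \<delta> i * \<epsilon> i - (\<delta> i)\<^sup>2 / 2)) * indicator (Pi\<^sub>E I A) \<epsilon> \<partial>?N)"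
      using A I by (intro emeasure_density) (auto intro!: sets_PiM_I_finite)
    also have "\<dots> = (\<integral>\<^sup>+\<epsilon>. (\<Prod>i\<in>I. ennreal (exp (\<delta> i * \<epsilon> i - (\<delta> i)\<^sup>2 / 2)) * indicator (A i) (\<epsilon> i)) \<partial>?N)"
    proof (rule nn_integral_cong)
      fix \<epsilon> assume "\<epsilon> \<in> space ?N"
      then have "(indicator (Pi\<^sub>E I A) \<epsilon> :: ennreal) = (\<Prod>i\<in>I. indicator (A i) (\<epsilon> i))"
        using I by (auto simp: space_PiM PiE_iff indicator_def intro: prod_zero)
      then show "ennreal (exp (\<Sum>i\<in>I. \<delta> i * \<epsilon> i - (\<delta> i)\<^sup>2 / 2)) * indicator (Pi\<^sub>E I A) \<epsilon> =
          (\<Prod>i\<in>I. ennreal (exp (\<delta> i * \<epsilon> i - (\<delta> i)\<^sup>2 / 2)) * indicator (A i) (\<epsilon> i))"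
        using I by (simp add: prod.distrib exp_sum prod_ennreal)
    qed
    also have "\<dots> = (\<Prod>i\<in>I. \<integral>\<^sup>+x. ennreal (exp (\<delta> i * x - (\<delta> i)\<^sup>2 / 2)) * indicator (A i) x \<partial>std_normal)"
      using A I by (intro N.product_nn_integral_prod) auto
    also have "\<dots> = (\<Prod>i\<in>I. emeasure (Q i) (A i))"
      using A by (intro prod.cong) (auto simp: Q_shift)
    finally show "emeasure (density ?N (\<lambda>\<epsilon>. ennreal (exp (\<Sum>i\<in>I. \<delta> i * \<epsilon> i - (\<delta> i)\<^sup>2 / 2)))) (Pi\<^sub>E I A) =
        (\<Prod>i\<in>I. emeasure (Q i) (A i))" .
  qed simp
  ultimately have "(\<integral>\<^sup>+\<epsilon>. g \<epsilon> \<partial>distr ?N ?B (\<lambda>\<epsilon>. \<lambda>i\<in>I. \<delta> i + \<epsilon> i)) =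
      (\<integral>\<^sup>+\<epsilon>. g \<epsilon> \<partial>density ?N (\<lambda>\<epsilon>. ennreal (exp (\<Sum>i\<in>I. \<delta> i * \<epsilon> i - (\<delta> i)\<^sup>2 / 2))))"
    by simp
  then show ?thesis
    by (subst (asm) nn_integral_distr, (simp; fail), (simp; fail), subst (asm) nn_integral_density) auto
qed

text \<open>
  The likelihood ratio is a probability density. With \<open>\<delta> / 2\<close> in place of \<open>\<delta>\<close> this also evaluates the
  mean of the square root of the likelihood ratio.
\<close>

lemma gaussian_product_exp:
  fixes \<delta> :: "'i \<Rightarrow> real"
  assumes I: "finite I"
  shows "(\<integral>\<^sup>+\<epsilon>. ennreal (exp (\<Sum>i\<in>I. \<delta> i * \<epsilon> i - (\<delta> i)\<^sup>2 / 2)) \<partial>Pi\<^sub>M I (\<lambda>_. std_normal)) = 1"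
proof -
  interpret prob_space "Pi\<^sub>M I (\<lambda>_. std_normal)"
    by (intro prob_space_PiM prob_space_std_normal)
  show ?thesis
    using gaussian_product_shift[OF I, of "\<lambda>_. 1" \<delta>] emeasure_space_1 by simp
qed

text \<open>
  Here \<open>s\<^sup>2\<close> stands for a likelihood ratio. The weighted sum of the squared errors of \<open>e\<close> is smallest
  at the weighted mean of \<open>a\<close> and \<open>b\<close>, with minimum \<open>(a - b)\<^sup>2 s\<^sup>2 / (1 + s\<^sup>2)\<close>. This function of \<open>s\<close> is
  bounded below by the quadratic \<open>(a - b)\<^sup>2 (3 s - 1 - s\<^sup>2) / 2\<close>, which touches it at \<open>s = 1\<close> and whose
  Gaussian mean is explicit.
\<close>

lemma weighted_squares_ge:
  fixes a b e s :: real
  shows "3 / 2 * (a - b)\<^sup>2 * s \<le> (e - a)\<^sup>2 + s\<^sup>2 * (e - b)\<^sup>2 + (a - b)\<^sup>2 * (1 + s\<^sup>2) / 2"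
proof -
  have rescale: "T * (3 / 2 * D * s) \<le> T * (V + D * T / 2)"
    if "D * (3 / 2 * s * T) \<le> T * V + D * (T\<^sup>2 / 2)" for T D V
    using that by (simp add: power2_eq_square algebra_simps)
  have "(1 + s\<^sup>2) * ((e - a)\<^sup>2 + s\<^sup>2 * (e - b)\<^sup>2) = ((e - a) + s\<^sup>2 * (e - b))\<^sup>2 + s\<^sup>2 * (a - b)\<^sup>2"
    by algebra
  then have 1: "(a - b)\<^sup>2 * s\<^sup>2 \<le> (1 + s\<^sup>2) * ((e - a)\<^sup>2 + s\<^sup>2 * (e - b)\<^sup>2)"
    by (simp add: mult.commute)
  \<comment> \<open>The second factor is \<open>s\<^sup>2 - s + 1\<close>.\<close>
  have "0 \<le> (s - 1)\<^sup>2 * ((s - 1/2)\<^sup>2 + 3/4)" by (intro mult_nonneg_nonneg) auto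
  also have "\<dots> = 2 * s\<^sup>2 + (1 + s\<^sup>2)\<^sup>2 - 3 * s * (1 + s\<^sup>2)"
    by (simp add: power2_eq_square algebra_simps)
  finally have "(a - b)\<^sup>2 * (3 / 2 * s * (1 + s\<^sup>2)) \<le> (a - b)\<^sup>2 * (s\<^sup>2 + (1 + s\<^sup>2)\<^sup>2 / 2)"
    by (intro mult_left_mono) auto
  also have "\<dots> \<le> (1 + s\<^sup>2) * ((e - a)\<^sup>2 + s\<^sup>2 * (e - b)\<^sup>2) + (a - b)\<^sup>2 * ((1 + s\<^sup>2)\<^sup>2 / 2)"
    using 1 by (simp add: distrib_left)
  finally have "(1 + s\<^sup>2) * (3 / 2 * (a - b)\<^sup>2 * s) \<le>
      (1 + s\<^sup>2) * ((e - a)\<^sup>2 + s\<^sup>2 * (e - b)\<^sup>2 + (a - b)\<^sup>2 * (1 + s\<^sup>2) / 2)"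
    by (rule rescale)
  moreover have "0 < 1 + s\<^sup>2" by (simp add: add_pos_nonneg)
  ultimately show ?thesis by (simp only: mult_le_cancel_left_pos)
qed

text \<open>
  No function \<open>e\<close> of the observations is close to \<open>a\<close> under the mean vector \<open>\<mu>\<close> and close to \<open>b\<close>
  under a nearby mean vector \<open>\<mu>'\<close>. Translating the noise expresses both errors under the same
  mean, the second one weighted by the likelihood ratio \<open>exp l\<close>, and \<open>weighted_squares_ge\<close>
  is integrated with \<open>s\<^sup>2 = exp l\<close>. The mean of \<open>s\<close> is \<open>exp (- S / 8)\<close>; estimating it by \<open>1 - S / 8\<close>
  makes the bound affine in \<open>S\<close>, hence easy to average over random designs.
\<close>

lemma two_point_gaussian:
  fixes e :: "('i \<Rightarrow> real) \<Rightarrow> real" and \<mu> \<mu>' :: "'i \<Rightarrow> real"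
  assumes I: "finite I" and e [measurable]: "e \<in> borel_measurable (Pi\<^sub>M I (\<lambda>_. borel))"
  defines "S \<equiv> (\<Sum>i\<in>I. (\<mu> i - \<mu>' i)\<^sup>2)"
  shows "ennreal ((a - b)\<^sup>2 * (1 / 2 - 3 / 16 * S)) \<le>
    (\<integral>\<^sup>+\<epsilon>. ennreal ((e (\<lambda>i\<in>I. \<mu> i + \<epsilon> i) - a)\<^sup>2) \<partial>Pi\<^sub>M I (\<lambda>_. std_normal)) +
    (\<integral>\<^sup>+\<epsilon>. ennreal ((e (\<lambda>i\<in>I. \<mu>' i + \<epsilon> i) - b)\<^sup>2) \<partial>Pi\<^sub>M I (\<lambda>_. std_normal))"
    (is "_ \<le> ?A + ?B")
proof -
  let ?N = "Pi\<^sub>M I (\<lambda>_. std_normal)"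
  define \<delta> where "\<delta> i = \<mu>' i - \<mu> i" for i
  define e' where "e' \<epsilon> = e (\<lambda>i\<in>I. \<mu> i + \<epsilon> i)" for \<epsilon>
  define l where "l \<epsilon> = (\<Sum>i\<in>I. \<delta> i * \<epsilon> i - (\<delta> i)\<^sup>2 / 2)" for \<epsilon>
  define h where "h \<epsilon> = (\<Sum>i\<in>I. \<delta> i / 2 * \<epsilon> i - (\<delta> i / 2)\<^sup>2 / 2)" for \<epsilon>
  have sets_N [simp, measurable_cong]: "sets ?N = sets (Pi\<^sub>M I (\<lambda>_. borel))" by (intro sets_PiM_cong) auto
  have [measurable]: "e' \<in> borel_measurable (Pi\<^sub>M I (\<lambda>_. borel))"
    unfolding e'_def by measurable
  have [measurable]: "l \<in> borel_measurable (Pi\<^sub>M I (\<lambda>_. borel))" "h \<in> borel_measurable (Pi\<^sub>M I (\<lambda>_. borel))"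
    unfolding l_def h_def by measurable
  have S: "S = (\<Sum>i\<in>I. (\<delta> i)\<^sup>2)"
    unfolding S_def \<delta>_def by (intro sum.cong) (auto simp: power2_commute)
  have l_eq: "l \<epsilon> / 2 = h \<epsilon> - S / 8" for \<epsilon>
    unfolding l_def h_def S sum_divide_distrib sum_subtractf[symmetric]
    by (intro sum.cong) (auto simp: power_divide field_simps)
  have "?B = (\<integral>\<^sup>+\<epsilon>. (\<lambda>\<epsilon>. ennreal ((e' \<epsilon> - b)\<^sup>2)) (\<lambda>i\<in>I. \<delta> i + \<epsilon> i) \<partial>?N)"
    by (intro nn_integral_cong) (simp add: e'_def \<delta>_def restrict_def cong: if_cong)
  also have "\<dots> = (\<integral>\<^sup>+\<epsilon>. ennreal (exp (l \<epsilon>)) * ennreal ((e' \<epsilon> - b)\<^sup>2) \<partial>?N)"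
    unfolding l_def by (intro gaussian_product_shift I) measurable
  finally have B: "?B = (\<integral>\<^sup>+\<epsilon>. ennreal (exp (l \<epsilon>) * (e' \<epsilon> - b)\<^sup>2) \<partial>?N)"
    by (simp add: ennreal_mult)
  have "ennreal (3 / 2 * (a - b)\<^sup>2 * exp (- S / 8)) =
      (\<integral>\<^sup>+\<epsilon>. ennreal (3 / 2 * (a - b)\<^sup>2 * exp (- S / 8)) * ennreal (exp (h \<epsilon>)) \<partial>?N)"
    using gaussian_product_exp[OF I, of "\<lambda>i. \<delta> i / 2", folded h_def] by (simp add: nn_integral_cmult)
  also have "\<dots> \<le> (\<integral>\<^sup>+\<epsilon>. (ennreal ((e' \<epsilon> - a)\<^sup>2) + ennreal (exp (l \<epsilon>) * (e' \<epsilon> - b)\<^sup>2)) +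
      (ennreal ((a - b)\<^sup>2 / 2) + ennreal ((a - b)\<^sup>2 / 2) * ennreal (exp (l \<epsilon>))) \<partial>?N)"
  proof (rule nn_integral_mono)
    fix \<epsilon>
    have sq: "exp (l \<epsilon>) = (exp (l \<epsilon> / 2))\<^sup>2" by (simp add: power2_eq_square exp_add[symmetric])
    have "exp (- S / 8) * exp (h \<epsilon>) = exp (l \<epsilon> / 2)" by (simp add: l_eq exp_add[symmetric])
    then have "3 / 2 * (a - b)\<^sup>2 * exp (- S / 8) * exp (h \<epsilon>) = 3 / 2 * (a - b)\<^sup>2 * exp (l \<epsilon> / 2)"
      by (simp only: mult.assoc)
    also have "\<dots> \<le> (e' \<epsilon> - a)\<^sup>2 + exp (l \<epsilon>) * (e' \<epsilon> - b)\<^sup>2 + (a - b)\<^sup>2 * (1 + exp (l \<epsilon>)) / 2"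
      unfolding sq by (rule weighted_squares_ge)
    also have "(a - b)\<^sup>2 * (1 + exp (l \<epsilon>)) / 2 = (a - b)\<^sup>2 / 2 + (a - b)\<^sup>2 / 2 * exp (l \<epsilon>)"
      by (simp add: distrib_left add_divide_distrib)
    finally have "3 / 2 * (a - b)\<^sup>2 * exp (- S / 8) * exp (h \<epsilon>) \<le>
        (e' \<epsilon> - a)\<^sup>2 + exp (l \<epsilon>) * (e' \<epsilon> - b)\<^sup>2 + ((a - b)\<^sup>2 / 2 + (a - b)\<^sup>2 / 2 * exp (l \<epsilon>))" .
    then show "ennreal (3 / 2 * (a - b)\<^sup>2 * exp (- S / 8)) * ennreal (exp (h \<epsilon>)) \<le>
        (ennreal ((e' \<epsilon> - a)\<^sup>2) + ennreal (exp (l \<epsilon>) * (e' \<epsilon> - b)\<^sup>2)) +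
        (ennreal ((a - b)\<^sup>2 / 2) + ennreal ((a - b)\<^sup>2 / 2) * ennreal (exp (l \<epsilon>)))"
      by (simp flip: ennreal_mult ennreal_plus)
  qed
  also have "\<dots> = ?A + ?B + ennreal ((a - b)\<^sup>2)"
  proof -
    interpret prob_space ?N by (intro prob_space_PiM prob_space_std_normal)
    have "(\<integral>\<^sup>+\<epsilon>. ennreal (exp (l \<epsilon>)) \<partial>?N) = 1"
      unfolding l_def by (rule gaussian_product_exp[OF I])
    moreover have "ennreal ((a - b)\<^sup>2 / 2) + ennreal ((a - b)\<^sup>2 / 2) = ennreal ((a - b)\<^sup>2)"
      by (simp flip: ennreal_plus)
    ultimately show ?thesis
      unfolding B by (simp add: nn_integral_add nn_integral_cmult emeasure_space_1 e'_def[symmetric]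
          del: ennreal_plus)
  qed
  finally have main: "ennreal (3 / 2 * (a - b)\<^sup>2 * exp (- S / 8)) \<le> ?A + ?B + ennreal ((a - b)\<^sup>2)" .
  have "1 - S / 8 \<le> exp (- S / 8)" using exp_ge_add_one_self[of "- S / 8"] by simp
  then have "3 / 2 * (a - b)\<^sup>2 * (1 - S / 8) \<le> 3 / 2 * (a - b)\<^sup>2 * exp (- S / 8)"
    by (intro mult_left_mono) auto
  then have "(a - b)\<^sup>2 * (1 / 2 - 3 / 16 * S) \<le> 3 / 2 * (a - b)\<^sup>2 * exp (- S / 8) - (a - b)\<^sup>2"
    by (simp add: algebra_simps)
  then have "ennreal ((a - b)\<^sup>2 * (1 / 2 - 3 / 16 * S)) \<le>
      ennreal (3 / 2 * (a - b)\<^sup>2 * exp (- S / 8)) - ennreal ((a - b)\<^sup>2)"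
    by (subst ennreal_minus) (auto intro: ennreal_leI)
  also have "\<dots> \<le> ?A + ?B"
    using main by (simp add: ennreal_minus_le_iff add.commute)
  finally show ?thesis .
qed

section \<open>Assouad's argument for regression with random design\<close>

lemma sum_Pow_pairs:
  fixes g :: "'a set \<Rightarrow> 'b::comm_monoid_add"
  assumes "finite U" "u \<in> U"
  shows "sum g (Pow U) = (\<Sum>w\<in>Pow (U - {u}). g w + g (insert u w))"
proof -
  have "Pow U = Pow (U - {u}) \<union> insert u ` Pow (U - {u})"
    using assms(2) Pow_insert[of u "U - {u}"] by (simp add: insert_absorb)
  also have "sum g \<dots> = sum g (Pow (U - {u})) + sum g (insert u ` Pow (U - {u}))"
    using assms(1) by (intro sum.union_disjoint) auto
  also have "sum g (insert u ` Pow (U - {u})) = (\<Sum>w\<in>Pow (U - {u}). g (insert u w))"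
    by (intro sum.reindex_cong[of "insert u"]) (auto simp: inj_on_def insert_eq_iff dest!: PowD)
  finally show ?thesis by (simp add: sum.distrib)
qed

text \<open>
  One fixed estimator, faced with arbitrary regression functions.
\<close>

locale regression_experiment = prob_space P for P :: "(nat \<Rightarrow> real) measure" +
  fixes d n :: nat and est :: "(nat \<Rightarrow> (nat \<Rightarrow> real) \<times> real) \<Rightarrow> (nat \<Rightarrow> real) \<Rightarrow> real"
  assumes sets_P: "sets P = sets (lebesgue_cube d)"
    and est: "est \<in> estimators d n"
begin

abbreviation designs :: "(nat \<Rightarrow> nat \<Rightarrow> real) measure" where
  "designs \<equiv> Pi\<^sub>M {..<n} (\<lambda>_. P)"

abbreviation noise :: "(nat \<Rightarrow> real) measure" where
  "noise \<equiv> Pi\<^sub>M {..<n} (\<lambda>_. std_normal)"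

definition loss :: "((nat \<Rightarrow> real) \<Rightarrow> real) \<Rightarrow> (nat \<Rightarrow> nat \<Rightarrow> real) \<Rightarrow> (nat \<Rightarrow> real) \<Rightarrow> (nat \<Rightarrow> real) \<Rightarrow> ennreal" where
  "loss f X \<epsilon> x = ennreal ((est (sample n f X \<epsilon>) x - f x)\<^sup>2)"

text \<open>
  The noise is integrated first, so that the two-point bound applies for each design and each point
  of evaluation.
\<close>

definition local_risk :: "((nat \<Rightarrow> real) \<Rightarrow> real) \<Rightarrow> (nat \<Rightarrow> real) set \<Rightarrow> ennreal" where
  "local_risk f A = (\<integral>\<^sup>+X. \<integral>\<^sup>+x. indicator A x * (\<integral>\<^sup>+\<epsilon>. loss f X \<epsilon> x \<partial>noise) \<partial>P \<partial>designs)"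

lemma est_measurable [measurable]:
  "(\<lambda>(z, x). est z x) \<in> borel_measurable (Pi\<^sub>M {..<n} (\<lambda>_. P \<Otimes>\<^sub>M borel) \<Otimes>\<^sub>M P)"
proof -
  have "sets (Pi\<^sub>M {..<n} (\<lambda>_. P \<Otimes>\<^sub>M borel) \<Otimes>\<^sub>M P) =
      sets (Pi\<^sub>M {..<n} (\<lambda>_. lebesgue_cube d \<Otimes>\<^sub>M (borel :: real measure)) \<Otimes>\<^sub>M lebesgue_cube d)"
    by (intro sets_pair_measure_cong sets_PiM_cong sets_P refl)
  then show ?thesis
    using est by (simp add: estimators_def cong: measurable_cong_sets)
qed

lemma prob_space_designs: "prob_space designs"
  by (intro prob_space_PiM) unfold_locales

lemma prob_space_noise: "prob_space noise"
  by (intro prob_space_PiM prob_space_std_normal)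

lemma loss_measurable:
  assumes [measurable]: "f \<in> borel_measurable P"
  shows "(\<lambda>(X, \<epsilon>, x). loss f X \<epsilon> x) \<in> borel_measurable (designs \<Otimes>\<^sub>M (noise \<Otimes>\<^sub>M P))"
proof -
  have "(\<lambda>(X, \<epsilon>, x). (sample n f X \<epsilon>, x)) \<in>
      measurable (designs \<Otimes>\<^sub>M (noise \<Otimes>\<^sub>M P)) (Pi\<^sub>M {..<n} (\<lambda>_. P \<Otimes>\<^sub>M borel) \<Otimes>\<^sub>M P)"
    unfolding sample_def by measurable
  from measurable_compose[OF this est_measurable]
  have [measurable]: "(\<lambda>(X, \<epsilon>, x). est (sample n f X \<epsilon>) x) \<in> borel_measurable (designs \<Otimes>\<^sub>M (noise \<Otimes>\<^sub>M P))"
    by (simp add: case_prod_beta')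
  have "(\<lambda>y. ennreal (((\<lambda>(X, \<epsilon>, x). est (sample n f X \<epsilon>) x) y - f (snd (snd y)))\<^sup>2))
      \<in> borel_measurable (designs \<Otimes>\<^sub>M (noise \<Otimes>\<^sub>M P))"
    by measurable
  then show ?thesis by (simp add: loss_def case_prod_beta')
qed

lemma inner_loss_measurable:
  assumes "f \<in> borel_measurable P"
  shows "(\<lambda>(X, x). \<integral>\<^sup>+\<epsilon>. loss f X \<epsilon> x \<partial>noise) \<in> borel_measurable (designs \<Otimes>\<^sub>M P)"
proof -
  interpret N: prob_space noise by (rule prob_space_noise)
  have "(\<lambda>y. (fst (fst y), snd y, snd (fst y))) \<in>
      measurable ((designs \<Otimes>\<^sub>M P) \<Otimes>\<^sub>M noise) (designs \<Otimes>\<^sub>M (noise \<Otimes>\<^sub>M P))"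
    by measurable
  from measurable_compose[OF this loss_measurable[OF assms]]
  show ?thesis
    by (subst case_prod_beta', intro N.borel_measurable_nn_integral) (simp add: case_prod_beta')
qed

lemma risk_eq: 
  assumes "f \<in> borel_measurable P"
  shows "risk P n est f = (\<integral>\<^sup>+X. \<integral>\<^sup>+x. \<integral>\<^sup>+\<epsilon>. loss f X \<epsilon> x \<partial>noise \<partial>P \<partial>designs)"
proof -
  interpret D: prob_space designs by (rule prob_space_designs)
  interpret N: prob_space noise by (rule prob_space_noise)
  interpret NP: pair_prob_space noise P ..
  have "risk P n est f = (\<integral>\<^sup>+X. \<integral>\<^sup>+y. (\<lambda>(X, \<epsilon>, x). loss f X \<epsilon> x) (X, y) \<partial>(noise \<Otimes>\<^sub>M P) \<partial>designs)"
    unfolding risk_def model_law_def loss_def[symmetric]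
    by (intro NP.nn_integral_fst[symmetric] loss_measurable assms)
  also have "\<dots> = (\<integral>\<^sup>+X. \<integral>\<^sup>+x. \<integral>\<^sup>+\<epsilon>. loss f X \<epsilon> x \<partial>noise \<partial>P \<partial>designs)"
  proof (rule nn_integral_cong)
    fix X assume X: "X \<in> space designs"
    have m: "(\<lambda>(\<epsilon>, x). loss f X \<epsilon> x) \<in> borel_measurable (noise \<Otimes>\<^sub>M P)"
      using measurable_compose[OF measurable_Pair1'[OF X] loss_measurable[OF assms]] by simp
    have "(\<integral>\<^sup>+y. (\<lambda>(X, \<epsilon>, x). loss f X \<epsilon> x) (X, y) \<partial>(noise \<Otimes>\<^sub>M P)) =
        (\<integral>\<^sup>+\<epsilon>. \<integral>\<^sup>+x. loss f X \<epsilon> x \<partial>P \<partial>noise)"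
      using nn_integral_fst[OF m] by simp
    also have "\<dots> = (\<integral>\<^sup>+x. \<integral>\<^sup>+\<epsilon>. loss f X \<epsilon> x \<partial>noise \<partial>P)"
      using NP.Fubini'[OF m] by simp
    finally show "(\<integral>\<^sup>+y. (\<lambda>(X, \<epsilon>, x). loss f X \<epsilon> x) (X, y) \<partial>(noise \<Otimes>\<^sub>M P)) =
        (\<integral>\<^sup>+x. \<integral>\<^sup>+\<epsilon>. loss f X \<epsilon> x \<partial>noise \<partial>P)" .
  qed
  finally show ?thesis .
qed

lemma sum_local_risk_le_risk:
  assumes f [measurable]: "f \<in> borel_measurable P" and U: "finite U" "disjoint_family_on A U"
    and A [measurable]: "\<And>u. u \<in> U \<Longrightarrow> A u \<in> sets P"
  shows "(\<Sum>u\<in>U. local_risk f (A u)) \<le> risk P n est f"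
proof -
  note inner_loss_measurable[OF f, measurable]
  have "(\<Sum>u\<in>U. local_risk f (A u)) =
      (\<integral>\<^sup>+X. \<integral>\<^sup>+x. (\<Sum>u\<in>U. indicator (A u) x * (\<integral>\<^sup>+\<epsilon>. loss f X \<epsilon> x \<partial>noise)) \<partial>P \<partial>designs)"
    unfolding local_risk_def
    by (subst nn_integral_sum[symmetric], measurable)
       (intro nn_integral_cong nn_integral_sum[symmetric], measurable)
  also have "\<dots> \<le> (\<integral>\<^sup>+X. \<integral>\<^sup>+x. \<integral>\<^sup>+\<epsilon>. loss f X \<epsilon> x \<partial>noise \<partial>P \<partial>designs)"
  proof (intro nn_integral_mono)
    fix X x
    have "(\<Sum>u\<in>U. indicator (A u) x :: ennreal) = indicator (\<Union>u\<in>U. A u) x"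
      using U by (simp add: indicator_UN_disjoint)
    then show "(\<Sum>u\<in>U. indicator (A u) x * (\<integral>\<^sup>+\<epsilon>. loss f X \<epsilon> x \<partial>noise)) \<le> (\<integral>\<^sup>+\<epsilon>. loss f X \<epsilon> x \<partial>noise)"
      by (simp add: sum_distrib_right[symmetric] indicator_def)
  qed
  finally show ?thesis by (simp add: risk_eq)
qed

lemma nn_integral_design_point:
  assumes "h \<in> borel_measurable P" "i < n"
  shows "(\<integral>\<^sup>+X. h (X i) \<partial>designs) = (\<integral>\<^sup>+x. h x \<partial>P)"
proof -
  have "(\<integral>\<^sup>+X. h (X i) \<partial>designs) = (\<integral>\<^sup>+x. h x \<partial>distr designs P (\<lambda>X. X i))"
    using assms by (intro nn_integral_distr[symmetric]) auto
  also have "distr designs P (\<lambda>X. X i) = P"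
    using assms(2) by (intro distr_PiM_component) (auto intro: prob_space_axioms)
  finally show ?thesis .
qed

text \<open>
  Conditionally on the design, \<open>two_point_gaussian\<close> applies at each point of evaluation in \<open>A\<close>, with \<open>S\<close>
  the sum of the squared differences of the two functions at the design points. On average over
  the design, \<open>S\<close> is \<open>n\<close> times the squared distance of the functions, thus at most 1. This leaves
  the fraction \<open>1/2 - 3/16 = 5/16\<close> of the energy on \<open>A\<close>.
\<close>

lemma two_point_local_risk:
  assumes [measurable]: "f \<in> borel_measurable P" "f' \<in> borel_measurable P" "A \<in> sets P"
    and close: "of_nat n * (\<integral>\<^sup>+x. ennreal ((f x - f' x)\<^sup>2) \<partial>P) \<le> 1"
  shows "ennreal (5 / 16) * (\<integral>\<^sup>+x. indicator A x * ennreal ((f x - f' x)\<^sup>2) \<partial>P) \<le>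
    local_risk f A + local_risk f' A"
proof -
  note inner_loss_measurable[of f, measurable] inner_loss_measurable[of f', measurable]
  interpret D: prob_space designs by (rule prob_space_designs)
  define S where "S X = (\<Sum>i<n. (f (X i) - f' (X i))\<^sup>2)" for X :: "nat \<Rightarrow> nat \<Rightarrow> real"
  define V where "V = (\<integral>\<^sup>+x. indicator A x * ennreal ((f x - f' x)\<^sup>2) \<partial>P)"
  have [measurable]: "S \<in> borel_measurable designs" unfolding S_def by measurable
  have pointwise: "ennreal ((f x - f' x)\<^sup>2 * (1 / 2 - 3 / 16 * S X)) \<le>
      (\<integral>\<^sup>+\<epsilon>. loss f X \<epsilon> x \<partial>noise) + (\<integral>\<^sup>+\<epsilon>. loss f' X \<epsilon> x \<partial>noise)"
    if X: "X \<in> space designs" and x: "x \<in> space P" for X x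
  proof -
    define e where "e y = est (\<lambda>i\<in>{..<n}. (X i, y i)) x" for y :: "nat \<Rightarrow> real"
    have [measurable]: "X i \<in> space P" if "i < n" for i
      using X that by (auto simp: space_PiM PiE_iff)
    have "(\<lambda>y. (\<lambda>i\<in>{..<n}. (X i, y i), x)) \<in>
        measurable (Pi\<^sub>M {..<n} (\<lambda>_. borel)) (Pi\<^sub>M {..<n} (\<lambda>_. P \<Otimes>\<^sub>M borel) \<Otimes>\<^sub>M P)"
      using x by measurable
    from measurable_compose[OF this est_measurable]
    have "e \<in> borel_measurable (Pi\<^sub>M {..<n} (\<lambda>_. borel))" by (simp add: e_def[abs_def])
    moreover have "loss g X \<epsilon> x = ennreal ((e (\<lambda>i\<in>{..<n}. g (X i) + \<epsilon> i) - g x)\<^sup>2)" for g \<epsilon>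
      unfolding loss_def e_def sample_def by (simp cong: restrict_cong)
    ultimately show ?thesis
      using two_point_gaussian[of "{..<n}" e "f x" "f' x" "\<lambda>i. f (X i)" "\<lambda>i. f' (X i)"]
      by (simp add: S_def)
  qed
  have "(\<integral>\<^sup>+X. ennreal (S X) \<partial>designs) = (\<Sum>i<n. \<integral>\<^sup>+X. ennreal ((f (X i) - f' (X i))\<^sup>2) \<partial>designs)"
    unfolding S_def by (subst nn_integral_sum[symmetric]) (auto simp: sum_ennreal)
  also have "\<dots> = (\<Sum>i<n. \<integral>\<^sup>+x. ennreal ((f x - f' x)\<^sup>2) \<partial>P)"
    by (intro sum.cong refl nn_integral_design_point) auto
  finally have S1: "(\<integral>\<^sup>+X. ennreal (S X) \<partial>designs) \<le> 1" using close by simp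
  \<comment> \<open>The function \<open>ennreal\<close> sends negative numbers to 0, so \<open>1 / 2 - 3 / 16 * S X\<close> is compared with
    its mean by moving the subtracted term to the other side.\<close>
  have "ennreal (1 / 2) = (\<integral>\<^sup>+X. ennreal (1 / 2) \<partial>designs)" by (simp add: D.emeasure_space_1)
  also have "\<dots> \<le> (\<integral>\<^sup>+X. ennreal (1 / 2 - 3 / 16 * S X) + ennreal (3 / 16) * ennreal (S X) \<partial>designs)"
  proof (intro nn_integral_mono)
    fix X
    have "0 \<le> S X" unfolding S_def by (intro sum_nonneg) auto
    then show "ennreal (1 / 2) \<le> ennreal (1 / 2 - 3 / 16 * S X) + ennreal (3 / 16) * ennreal (S X)"
      by (cases "3 / 16 * S X \<le> 1 / 2")
        (auto simp: ennreal_neg intro: ennreal_leI simp flip: ennreal_plus ennreal_mult simp del: ennreal_half)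
  qed
  also have "\<dots> = (\<integral>\<^sup>+X. ennreal (1 / 2 - 3 / 16 * S X) \<partial>designs) +
      ennreal (3 / 16) * (\<integral>\<^sup>+X. ennreal (S X) \<partial>designs)"
    by (simp add: nn_integral_add nn_integral_cmult)
  also have "\<dots> \<le> (\<integral>\<^sup>+X. ennreal (1 / 2 - 3 / 16 * S X) \<partial>designs) + ennreal (3 / 16) * 1"
    by (intro add_left_mono mult_left_mono S1) auto
  finally have half: "ennreal (1 / 2) - ennreal (3 / 16) \<le> (\<integral>\<^sup>+X. ennreal (1 / 2 - 3 / 16 * S X) \<partial>designs)"
    by (simp add: ennreal_minus_le_iff add.commute)
  have "ennreal (5 / 16) = ennreal (1 / 2) - ennreal (3 / 16)"
    by (subst ennreal_minus) simp_all
  also note half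
  finally have "ennreal (5 / 16) * V \<le> (\<integral>\<^sup>+X. ennreal (1 / 2 - 3 / 16 * S X) \<partial>designs) * V"
    by (rule mult_right_mono) simp
  also have "\<dots> = (\<integral>\<^sup>+X. \<integral>\<^sup>+x. ennreal (1 / 2 - 3 / 16 * S X) * (indicator A x * ennreal ((f x - f' x)\<^sup>2)) \<partial>P \<partial>designs)"
    unfolding V_def by (simp add: nn_integral_multc nn_integral_cmult)
  also have "\<dots> \<le> (\<integral>\<^sup>+X. \<integral>\<^sup>+x. indicator A x * (\<integral>\<^sup>+\<epsilon>. loss f X \<epsilon> x \<partial>noise) +
      indicator A x * (\<integral>\<^sup>+\<epsilon>. loss f' X \<epsilon> x \<partial>noise) \<partial>P \<partial>designs)"
  proof (intro nn_integral_mono)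
    fix X x assume "X \<in> space designs" "x \<in> space P"
    from pointwise[OF this]
    show "ennreal (1 / 2 - 3 / 16 * S X) * (indicator A x * ennreal ((f x - f' x)\<^sup>2)) \<le>
        indicator A x * (\<integral>\<^sup>+\<epsilon>. loss f X \<epsilon> x \<partial>noise) + indicator A x * (\<integral>\<^sup>+\<epsilon>. loss f' X \<epsilon> x \<partial>noise)"
      by (auto simp: indicator_def ennreal_mult'' mult.commute ennreal_mult')
  qed
  also have "\<dots> = (\<integral>\<^sup>+X. (\<integral>\<^sup>+x. indicator A x * (\<integral>\<^sup>+\<epsilon>. loss f X \<epsilon> x \<partial>noise) \<partial>P) +
      (\<integral>\<^sup>+x. indicator A x * (\<integral>\<^sup>+\<epsilon>. loss f' X \<epsilon> x \<partial>noise) \<partial>P) \<partial>designs)"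
    by (intro nn_integral_cong nn_integral_add) measurable
  also have "\<dots> = local_risk f A + local_risk f' A"
    unfolding local_risk_def by (intro nn_integral_add) measurable
  finally show ?thesis by (simp add: V_def)
qed

text \<open>
  The risk at each vertex \<open>w\<close> of the hypercube is at least the sum of the local risks on the supports
  \<open>A u\<close>. For fixed \<open>u\<close>, pair the vertices that differ only in \<open>u\<close>: each of the \<open>2 ^ (card U - 1)\<close> pairs
  has local risk at least \<open>5/16\<close> of the energy of \<open>\<psi> u\<close>. So the mean risk over all vertices is at least
  \<open>5/32\<close> of the total energy, and the worst vertex is no better than the mean.
\<close>

lemma assouad_lower_bound:
  fixes \<psi> :: "'u \<Rightarrow> (nat \<Rightarrow> real) \<Rightarrow> real"
  assumes U: "finite U" and \<psi> [measurable]: "\<And>u. u \<in> U \<Longrightarrow> \<psi> u \<in> borel_measurable P"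
    and disj: "\<And>x u v. x \<in> space P \<Longrightarrow> u \<in> U \<Longrightarrow> v \<in> U \<Longrightarrow> \<psi> u x \<noteq> 0 \<Longrightarrow> \<psi> v x \<noteq> 0 \<Longrightarrow> u = v"
    and close: "\<And>u. u \<in> U \<Longrightarrow> of_nat n * (\<integral>\<^sup>+x. ennreal ((\<psi> u x)\<^sup>2) \<partial>P) \<le> 1"
  shows "\<exists>w \<subseteq> U. ennreal (5 / 32) * (\<Sum>u\<in>U. \<integral>\<^sup>+x. ennreal ((\<psi> u x)\<^sup>2) \<partial>P) \<le>
    risk P n est (\<lambda>x. \<Sum>u\<in>w. \<psi> u x)"
proof -
  define F where "F w x = (\<Sum>u\<in>w. \<psi> u x)" for w x
  define A where "A u = {x \<in> space P. \<psi> u x \<noteq> 0}" for u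
  define V where "V u = (\<integral>\<^sup>+x. ennreal ((\<psi> u x)\<^sup>2) \<partial>P)" for u
  define N where "N = (2::real) ^ card U"
  have N: "0 < N" by (simp add: N_def)
  have F [measurable]: "F w \<in> borel_measurable P" if "w \<subseteq> U" for w
    unfolding F_def using that by (intro borel_measurable_sum) auto
  have A: "A u \<in> sets P" if "u \<in> U" for u
    unfolding A_def using \<psi>[OF that] by measurable
  have disjA: "disjoint_family_on A U"
    using disj by (auto simp: disjoint_family_on_def A_def)
  have pair: "ennreal (5 / 16) * V u \<le> local_risk (F w) (A u) + local_risk (F (insert u w)) (A u)"
    if u: "u \<in> U" and w: "w \<in> Pow (U - {u})" for u w
  proof -
    have diff: "F w x - F (insert u w) x = - \<psi> u x" for x
      using w U finite_subset[of w U] unfolding F_def by (subst sum.insert) auto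
    have V: "(\<integral>\<^sup>+x. indicator (A u) x * ennreal ((F w x - F (insert u w) x)\<^sup>2) \<partial>P) = V u"
      unfolding V_def diff by (intro nn_integral_cong) (auto simp: A_def indicator_def)
    have "ennreal (5 / 16) * (\<integral>\<^sup>+x. indicator (A u) x * ennreal ((F w x - F (insert u w) x)\<^sup>2) \<partial>P) \<le>
        local_risk (F w) (A u) + local_risk (F (insert u w)) (A u)"
      using u w close[OF u] by (intro two_point_local_risk F A) (auto simp: diff)
    then show ?thesis by (simp only: V)
  qed
  have "ennreal (N / 2) * (ennreal (5 / 16) * (\<Sum>u\<in>U. V u)) =
      (\<Sum>u\<in>U. \<Sum>w\<in>Pow (U - {u}). ennreal (5 / 16) * V u)"
  proof -
    have "of_nat (card (Pow (U - {u}))) = ennreal (N / 2)" if "u \<in> U" for u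
    proof -
      have "2 ^ card U = (2::real) * 2 ^ card (U - {u})"
        unfolding card.remove[OF U that] by (rule power_Suc)
      moreover have "card (Pow (U - {u})) = 2 ^ card (U - {u})"
        using U by (intro card_Pow) simp
      ultimately show ?thesis
        by (simp only: N_def ennreal_of_nat_eq_real_of_nat of_nat_power of_nat_numeral) simp
    qed
    then show ?thesis by (simp add: sum_distrib_left)
  qed
  also have "\<dots> \<le> (\<Sum>u\<in>U. \<Sum>w\<in>Pow (U - {u}). local_risk (F w) (A u) + local_risk (F (insert u w)) (A u))"
    by (intro sum_mono pair)
  also have "\<dots> = (\<Sum>u\<in>U. \<Sum>w\<in>Pow U. local_risk (F w) (A u))"
    by (intro sum.cong refl sum_Pow_pairs[symmetric] U)
  also have "\<dots> = (\<Sum>w\<in>Pow U. \<Sum>u\<in>U. local_risk (F w) (A u))"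
    by (rule sum.swap)
  also have "\<dots> \<le> (\<Sum>w\<in>Pow U. risk P n est (F w))"
    using F A by (intro sum_mono sum_local_risk_le_risk U disjA) auto
  also have "\<dots> \<le> (\<Sum>w\<in>Pow U. Max ((\<lambda>w. risk P n est (F w)) ` Pow U))"
    using U by (intro sum_mono Max_ge) auto
  also have "\<dots> = ennreal N * Max ((\<lambda>w. risk P n est (F w)) ` Pow U)"
    using U by (simp add: card_Pow N_def ennreal_of_nat_eq_real_of_nat)
  finally have *: "ennreal (N / 2) * (ennreal (5 / 16) * (\<Sum>u\<in>U. V u)) \<le>
      ennreal N * Max ((\<lambda>w. risk P n est (F w)) ` Pow U)" .
  have "Max ((\<lambda>w. risk P n est (F w)) ` Pow U) \<in> (\<lambda>w. risk P n est (F w)) ` Pow U"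
    using U by (intro Max_in) auto
  then obtain w where w: "w \<subseteq> U" "Max ((\<lambda>w. risk P n est (F w)) ` Pow U) = risk P n est (F w)"
    by auto
  have "ennreal (5 / 32) * (\<Sum>u\<in>U. V u) = ennreal (1 / N) * (ennreal (N / 2) * (ennreal (5 / 16) * (\<Sum>u\<in>U. V u)))"
    using N by (simp add: mult.assoc[symmetric] ennreal_mult[symmetric])
  also have "\<dots> \<le> ennreal (1 / N) * (ennreal N * risk P n est (F w))"
    using * unfolding w(2) by (rule mult_left_mono) simp
  also have "\<dots> = risk P n est (F w)"
    using N by (simp add: mult.assoc[symmetric] ennreal_mult[symmetric])
  finally show ?thesis
    using w(1) by (auto simp: V_def F_def[abs_def])
qed

end

section \<open>Masses of boxes under the design\<close>

lemma space_lebesgue_cube: "space (lebesgue_cube d) = cube 0 1 d"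
  by (auto simp: lebesgue_cube_def space_restrict_space space_PiM cube_def)

lemma cube_in_sets: "cube 0 1 d \<in> sets (Pi\<^sub>M {..<d} (\<lambda>_. lborel))"
  unfolding cube_def by (intro sets_PiM_I_finite) auto

lemma coordinate_measurable_lebesgue_cube:
  "j < d \<Longrightarrow> (\<lambda>x. x j) \<in> borel_measurable (lebesgue_cube d)"
  unfolding lebesgue_cube_def
  by (intro measurable_restrict_space1) (use measurable_component_singleton[of j "{..<d}" "\<lambda>_. lborel"] in simp)

text \<open>
  Only the first \<open>t\<close> coordinates are constrained: the perturbations do not depend on the others.
\<close>

definition subcube :: "nat \<Rightarrow> nat \<Rightarrow> real \<Rightarrow> (nat \<Rightarrow> real) \<Rightarrow> (nat \<Rightarrow> real) set" where
  "subcube d t w lo = {x \<in> cube 0 1 d. \<forall>j<t. x j \<in> {lo j..lo j + w}}"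

lemma emeasure_subcube:
  assumes "t \<le> d" "0 \<le> w" "\<And>j. j < t \<Longrightarrow> 0 \<le> lo j \<and> lo j + w \<le> 1"
  shows "subcube d t w lo \<in> sets (lebesgue_cube d)" "emeasure (lebesgue_cube d) (subcube d t w lo) = ennreal (w ^ t)"
proof -
  define I where "I j = (if j < t then {lo j..lo j + w} else {0..1})" for j
  have box: "subcube d t w lo = Pi\<^sub>E {..<d} I"
  proof -
    have I: "x j \<in> I j \<longleftrightarrow> x j \<in> {0..1} \<and> (j < t \<longrightarrow> x j \<in> {lo j..lo j + w})" for x :: "nat \<Rightarrow> real" and j
    proof (cases "j < t")
      case True
      then show ?thesis using assms(3)[OF True] unfolding I_def by auto
    qed (simp add: I_def)
    have "x \<in> subcube d t w lo \<longleftrightarrow> x \<in> Pi\<^sub>E {..<d} I" for x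
      unfolding subcube_def cube_def PiE_iff mem_Collect_eq I
      using assms(1) by (meson lessThan_iff less_le_trans)
    then show ?thesis by blast
  qed
  have sub: "subcube d t w lo \<subseteq> cube 0 1 d" by (auto simp: subcube_def)
  have sets: "subcube d t w lo \<in> sets (Pi\<^sub>M {..<d} (\<lambda>_. lborel))"
    unfolding box by (intro sets_PiM_I_finite) (auto simp: I_def)
  then show "subcube d t w lo \<in> sets (lebesgue_cube d)"
    unfolding lebesgue_cube_def using sub cube_in_sets by (simp add: sets_restrict_space_iff)
  interpret product_sigma_finite "\<lambda>_::nat. lborel :: real measure" ..
  have "emeasure (lebesgue_cube d) (subcube d t w lo) = emeasure (Pi\<^sub>M {..<d} (\<lambda>_. lborel)) (subcube d t w lo)"
    unfolding lebesgue_cube_def using sub cube_in_sets by (intro emeasure_restrict_space) auto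
  also have "\<dots> = (\<Prod>j<d. emeasure lborel (I j))"
    unfolding box by (intro emeasure_PiM) (auto simp: I_def)
  also have "\<dots> = (\<Prod>j<d. if j < t then ennreal w else 1)"
    using assms(2) by (intro prod.cong) (auto simp: I_def)
  also have "\<dots> = (\<Prod>j\<in>{j. j < d \<and> j < t}. ennreal w)"
    by (subst prod.inter_filter[symmetric]) (auto intro!: prod.cong)
  also have "{j. j < d \<and> j < t} = {..<t}" using assms(1) by auto
  finally show "emeasure (lebesgue_cube d) (subcube d t w lo) = ennreal (w ^ t)"
    using assms(2) by (simp add: ennreal_power)
qed

lemma density_subcube_bounds:
  assumes P: "P = density (lebesgue_cube d) (\<lambda>x. ennreal (p x))"
    and p [measurable]: "p \<in> borel_measurable (lebesgue_cube d)"
    and bounds: "0 \<le> p_min" "0 \<le> p_max" "\<And>x. x \<in> cube 0 1 d \<Longrightarrow> p_min \<le> p x \<and> p x \<le> p_max"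
    and box: "t \<le> d" "0 \<le> w" "\<And>j. j < t \<Longrightarrow> 0 \<le> lo j \<and> lo j + w \<le> 1"
  shows "ennreal (p_min * w ^ t) \<le> emeasure P (subcube d t w lo)" "emeasure P (subcube d t w lo) \<le> ennreal (p_max * w ^ t)"
proof -
  note [measurable] = emeasure_subcube(1)[OF box]
  have eq: "emeasure P (subcube d t w lo) = (\<integral>\<^sup>+x. ennreal (p x) * indicator (subcube d t w lo) x \<partial>lebesgue_cube d)"
    unfolding P by (intro emeasure_density) auto
  have const: "(\<integral>\<^sup>+x. ennreal c * indicator (subcube d t w lo) x \<partial>lebesgue_cube d) = ennreal (c * w ^ t)"
    if "0 \<le> c" for c
    using that emeasure_subcube[OF box] \<open>0 \<le> w\<close> by (simp add: nn_integral_cmult_indicator ennreal_mult)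
  show "ennreal (p_min * w ^ t) \<le> emeasure P (subcube d t w lo)"
    unfolding eq const[OF bounds(1), symmetric] using bounds(3)
    by (intro nn_integral_mono mult_right_mono ennreal_leI) (auto simp: space_lebesgue_cube)
  show "emeasure P (subcube d t w lo) \<le> ennreal (p_max * w ^ t)"
    unfolding eq const[OF bounds(2), symmetric] using bounds(3)
    by (intro nn_integral_mono mult_right_mono ennreal_leI) (auto simp: space_lebesgue_cube)
qed

section \<open>Energies of the perturbations\<close>

text \<open>
  The contribution of the cell \<open>u\<close> to the composition: the bump of the perturbed layer, raised to the
  power \<open>B\<close> by the later layers.
\<close>

definition peak ::
    "(nat \<Rightarrow> real \<Rightarrow> real) \<Rightarrow> nat \<Rightarrow> nat \<Rightarrow> real \<Rightarrow> real \<Rightarrow> (nat \<Rightarrow> nat) \<Rightarrow> (nat \<Rightarrow> real) \<Rightarrow> real" where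
  "peak k t m b B u x = (real m powr (- b) * cell_bump k t m (\<lambda>_. 0) u x) powr B"

lemma cell_bump_restrict: "cell_bump k t m \<alpha> u (\<lambda>j\<in>{..<t}. x j) = cell_bump k t m \<alpha> u x"
  by (simp add: cell_bump_def)

lemma cell_bump_nonneg: "smooth_bump s \<kappa> k \<Longrightarrow> 0 \<le> cell_bump k t m (\<lambda>_. 0) u x"
  unfolding cell_bump_def by (intro prod_nonneg) (simp add: smooth_bump_def)

lemma peak_measurable:
  assumes "smooth_bump s \<kappa> k" "t \<le> d"
  shows "peak k t m b B u \<in> borel_measurable (lebesgue_cube d)"
proof -
  have "isCont (k 0) x" for x
    using assms(1) unfolding smooth_bump_def by (meson DERIV_isCont zero_le)
  then have [measurable]: "k 0 \<in> borel_measurable borel"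
    by (intro borel_measurable_continuous_onI continuous_at_imp_continuous_on) auto
  have "(\<lambda>x. k 0 (real m * x j - real (u j))) \<in> borel_measurable (lebesgue_cube d)" if "j < t" for j
  proof -
    have [measurable]: "(\<lambda>x. x j) \<in> borel_measurable (lebesgue_cube d)"
      using that assms(2) by (intro coordinate_measurable_lebesgue_cube) simp
    show ?thesis by measurable
  qed
  then have [measurable]: "(\<lambda>x. cell_bump k t m (\<lambda>_. 0) u x) \<in> borel_measurable (lebesgue_cube d)"
    unfolding cell_bump_def by (intro borel_measurable_prod) auto
  show ?thesis unfolding peak_def[abs_def] by measurable
qed

lemma peak_nonzero_imp: "peak k t m b B u x \<noteq> 0 \<Longrightarrow> cell_bump k t m (\<lambda>_. 0) u x \<noteq> 0"
  by (auto simp: peak_def)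

text \<open>
  At most one summand is nonzero, so taking a power commutes with summation; where all of them
  vanish, this relies on \<open>0 powr B = 0\<close>.
\<close>

lemma sum_peak_eq:
  assumes "smooth_bump s \<kappa> k" "W \<subseteq> grid t m"
  shows "(\<Sum>u\<in>W. peak k t m b B u x) = (real m powr (- b) * bump_sum k t m W (\<lambda>_. 0) x) powr B"
proof (rule sum_disjoint_cases[of W "\<lambda>u. cell_bump k t m (\<lambda>_. 0) u x"])
  show fin: "finite W" using assms(2) finite_grid finite_subset by blast
  fix u v assume "u \<in> W" "v \<in> W" "cell_bump k t m (\<lambda>_. 0) u x \<noteq> 0" "cell_bump k t m (\<lambda>_. 0) v x \<noteq> 0"
  then show "u = v" using cell_bump_disjoint[OF assms(1)] assms(2) by (metis le0 multi_order_zero subsetD)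
next
  assume "\<And>v. v \<in> W \<Longrightarrow> cell_bump k t m (\<lambda>_. 0) v x = 0"
    "(\<Sum>u\<in>W. cell_bump k t m (\<lambda>_. 0) u x) = 0"
  then show ?thesis by (simp add: peak_def bump_sum_def)
next
  fix u assume u: "u \<in> W" "(\<Sum>u\<in>W. cell_bump k t m (\<lambda>_. 0) u x) = cell_bump k t m (\<lambda>_. 0) u x"
    "\<And>v. v \<in> W \<Longrightarrow> v \<noteq> u \<Longrightarrow> cell_bump k t m (\<lambda>_. 0) v x = 0"
  have fin: "finite W" using assms(2) finite_grid finite_subset by blast
  have "(\<Sum>u\<in>W. peak k t m b B u x) = peak k t m b B u x + (\<Sum>u\<in>W - {u}. peak k t m b B u x)"
    by (rule sum.remove[OF fin u(1)])
  also have "(\<Sum>u\<in>W - {u}. peak k t m b B u x) = 0"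
    using u(3) by (intro sum.neutral) (auto simp: peak_def)
  finally show ?thesis using u(2) by (simp add: peak_def bump_sum_def)
qed

text \<open>
  The perturbation is at most \<open>m powr (- b B)\<close>, and it lives on a single cell.
\<close>

lemma peak_energy_upper:
  assumes P: "P = density (lebesgue_cube d) (\<lambda>x. ennreal (p x))"
    and p: "p \<in> borel_measurable (lebesgue_cube d)"
    and p_pos: "0 < p_min" "0 < p_max"
    and p_bounds: "\<And>x. x \<in> cube 0 1 d \<Longrightarrow> p_min \<le> p x \<and> p x \<le> p_max"
    and k: "smooth_bump s \<kappa> k" and t: "t \<le> d" and m: "1 \<le> m" and B: "0 \<le> B" and u: "u \<in> grid t m"
  shows "(\<integral>\<^sup>+x. ennreal ((peak k t m b B u x)\<^sup>2) \<partial>P) \<le> ennreal ((real m powr (- b * B))\<^sup>2 * (p_max * (1 / real m) ^ t))"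
proof -
  note subcube_bounds = density_subcube_bounds[OF P p less_imp_le[OF p_pos(1)] less_imp_le[OF p_pos(2)] p_bounds]
  define Q where "Q = subcube d t (1 / real m) (\<lambda>j. real (u j) / real m)"
  have uj: "u j < m" if "j < t" for j using u that by (auto simp: grid_def PiE_iff)
  have inside: "0 \<le> real (u j) / real m \<and> real (u j) / real m + 1 / real m \<le> 1" if "j < t" for j
    using uj[OF that] m by (simp add: add_divide_distrib[symmetric])
  have Q: "Q \<in> sets P" "emeasure P Q \<le> ennreal (p_max * (1 / real m) ^ t)"
    unfolding Q_def using t inside by (auto simp: P[THEN arg_cong[of _ _ sets]] intro!: emeasure_subcube subcube_bounds)
  have "(\<integral>\<^sup>+x. ennreal ((peak k t m b B u x)\<^sup>2) \<partial>P) \<le>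
      (\<integral>\<^sup>+x. ennreal ((real m powr (- b * B))\<^sup>2) * indicator Q x \<partial>P)"
  proof (rule nn_integral_mono)
    fix x assume x: "x \<in> space P"
    show "ennreal ((peak k t m b B u x)\<^sup>2) \<le> ennreal ((real m powr (- b * B))\<^sup>2) * indicator Q x"
    proof (cases "peak k t m b B u x = 0")
      case False
      note nz = peak_nonzero_imp[OF False]
      have "x j \<in> {real (u j) / real m..real (u j) / real m + 1 / real m}" if "j < t" for j
        using cell_bump_support[OF k _ nz that] m by (simp add: field_simps)
      then have "x \<in> Q" using x by (auto simp: Q_def subcube_def P space_lebesgue_cube)
      have le: "cell_bump k t m (\<lambda>_. 0) u x \<le> 1"
        using abs_cell_bump_le[OF k, of t "\<lambda>_. 0" m u x] by simp
      have "peak k t m b B u x \<le> (real m powr (- b)) powr B"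
        unfolding peak_def using le B cell_bump_nonneg[OF k]
        by (intro powr_mono2) (auto intro!: mult_left_le)
      then have "(peak k t m b B u x)\<^sup>2 \<le> (real m powr (- b * B))\<^sup>2"
        by (intro power_mono) (auto simp: powr_powr peak_def)
      then show ?thesis using \<open>x \<in> Q\<close> by (simp add: ennreal_leI)
    qed simp
  qed
  also have "\<dots> = ennreal ((real m powr (- b * B))\<^sup>2) * emeasure P Q"
    using Q(1) by (rule nn_integral_cmult_indicator)
  also have "\<dots> \<le> ennreal ((real m powr (- b * B))\<^sup>2) * ennreal (p_max * (1 / real m) ^ t)"
    using Q(2) by (rule mult_left_mono) simp
  finally show ?thesis using p_pos by (simp add: ennreal_mult)
qed

text \<open>
  On the concentric box with half the side length, every factor of the bump is at least \<open>\<kappa>\<close>.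
\<close>

lemma peak_energy_lower:
  assumes P: "P = density (lebesgue_cube d) (\<lambda>x. ennreal (p x))"
    and p: "p \<in> borel_measurable (lebesgue_cube d)"
    and p_pos: "0 < p_min" "0 < p_max"
    and p_bounds: "\<And>x. x \<in> cube 0 1 d \<Longrightarrow> p_min \<le> p x \<and> p x \<le> p_max"
    and k: "smooth_bump s \<kappa> k" and t: "t \<le> d" and m: "1 \<le> m" and B: "0 \<le> B" and u: "u \<in> grid t m"
  shows "ennreal ((real m powr (- b * B) * (\<kappa> ^ t) powr B)\<^sup>2 * (p_min * (1 / (2 * real m)) ^ t)) \<le>
    (\<integral>\<^sup>+x. ennreal ((peak k t m b B u x)\<^sup>2) \<partial>P)"
proof -
  note subcube_bounds = density_subcube_bounds[OF P p less_imp_le[OF p_pos(1)] less_imp_le[OF p_pos(2)] p_bounds]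
  define Q where "Q = subcube d t (1 / (2 * real m)) (\<lambda>j. (real (u j) + 1 / 4) / real m)"
  have \<kappa>: "0 < \<kappa>" using k by (simp add: smooth_bump_def)
  have uj: "u j < m" if "j < t" for j using u that by (auto simp: grid_def PiE_iff)
  have inside: "0 \<le> (real (u j) + 1 / 4) / real m \<and>
      (real (u j) + 1 / 4) / real m + 1 / (2 * real m) \<le> 1" if "j < t" for j
    using uj[OF that] m by (simp add: field_simps)
  have Q: "Q \<in> sets P" "ennreal (p_min * (1 / (2 * real m)) ^ t) \<le> emeasure P Q"
    unfolding Q_def using t inside by (auto simp: P[THEN arg_cong[of _ _ sets]] intro!: emeasure_subcube subcube_bounds)
  have "ennreal ((real m powr (- b * B) * (\<kappa> ^ t) powr B)\<^sup>2 * (p_min * (1 / (2 * real m)) ^ t)) =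
      ennreal ((real m powr (- b * B) * (\<kappa> ^ t) powr B)\<^sup>2) * ennreal (p_min * (1 / (2 * real m)) ^ t)"
    using p_pos by (intro ennreal_mult) auto
  also have "\<dots> \<le> ennreal ((real m powr (- b * B) * (\<kappa> ^ t) powr B)\<^sup>2) * emeasure P Q"
    using Q(2) by (rule mult_left_mono) simp
  also have "\<dots> = (\<integral>\<^sup>+x. ennreal ((real m powr (- b * B) * (\<kappa> ^ t) powr B)\<^sup>2) * indicator Q x \<partial>P)"
    using Q(1) by (rule nn_integral_cmult_indicator[symmetric])
  also have "\<dots> \<le> (\<integral>\<^sup>+x. ennreal ((peak k t m b B u x)\<^sup>2) \<partial>P)"
  proof (rule nn_integral_mono)
    fix x
    show "ennreal ((real m powr (- b * B) * (\<kappa> ^ t) powr B)\<^sup>2) * indicator Q x \<le> ennreal ((peak k t m b B u x)\<^sup>2)"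
    proof (cases "x \<in> Q")
      case True
      have "\<kappa> \<le> k 0 (real m * x j - real (u j))" if "j < t" for j
      proof -
        have "x j \<in> {(real (u j) + 1 / 4) / real m..(real (u j) + 1 / 4) / real m + 1 / (2 * real m)}"
          using True that by (auto simp: Q_def subcube_def)
        then have "real m * x j - real (u j) \<in> {1/4..3/4}"
          using m by (simp add: field_simps)
        then show ?thesis using k by (simp add: smooth_bump_def)
      qed
      then have "(\<Prod>j<t. \<kappa>) \<le> cell_bump k t m (\<lambda>_. 0) u x"
        unfolding cell_bump_def using \<kappa> by (intro prod_mono) auto
      then have "(real m powr (- b) * \<kappa> ^ t) powr B \<le> peak k t m b B u x"
        unfolding peak_def using B \<kappa> by (intro powr_mono2 mult_left_mono) auto
      then have "real m powr (- b * B) * (\<kappa> ^ t) powr B \<le> peak k t m b B u x"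
        using \<kappa> by (simp add: powr_mult powr_powr)
      then show ?thesis
        using True by (auto intro!: ennreal_leI power_mono)
    qed simp
  qed
  finally show ?thesis .
qed

text \<open>
  The condition on \<open>m\<close> makes \<open>n\<close> times the energy of one perturbation at most 1. In the sum of
  the energies, the number \<open>m ^ t\<close> of cells cancels the volume of a cell.
\<close>

lemma grid_lower_bound:
  assumes prob: "prob_space P" and P: "P = density (lebesgue_cube d) (\<lambda>x. ennreal (p x))"
    and p: "p \<in> borel_measurable (lebesgue_cube d)"
    and p_pos: "0 < p_min" "0 < p_max"
    and p_bounds: "\<And>x. x \<in> cube 0 1 d \<Longrightarrow> p_min \<le> p x \<and> p x \<le> p_max"
    and k: "smooth_bump s \<kappa> k" and t: "t \<le> d" and m: "1 \<le> m" and B: "0 \<le> B"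
    and est: "est \<in> estimators d n"
    and fine: "real n * p_max \<le> real m powr (2 * (b * B) + real t)"
  shows "\<exists>W \<subseteq> grid t m. ennreal (5 / 32 * (p_min * (1 / 2) ^ t * ((\<kappa> ^ t) powr B)\<^sup>2 * real m powr (- 2 * (b * B)))) \<le>
    risk P n est (\<lambda>x. (real m powr (- b) * bump_sum k t m W (\<lambda>_. 0) x) powr B)"
proof -
  have model: "regression_experiment P d n est"
    using prob est by (auto simp: regression_experiment_def regression_experiment_axioms_def P)
  have sq: "(real m powr (- b * B))\<^sup>2 = real m powr (- 2 * (b * B))"
    by (simp add: power2_eq_square powr_add[symmetric] mult.commute)
  have mt: "real m ^ t = real m powr real t"
    using m by (simp add: powr_realpow)
  have "\<exists>W \<subseteq> grid t m. ennreal (5 / 32) * (\<Sum>u\<in>grid t m. \<integral>\<^sup>+x. ennreal ((peak k t m b B u x)\<^sup>2) \<partial>P) \<le>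
      risk P n est (\<lambda>x. \<Sum>u\<in>W. peak k t m b B u x)"
  proof (rule regression_experiment.assouad_lower_bound[OF model])
    show "peak k t m b B u \<in> borel_measurable P" for u
      using peak_measurable[OF k t] by (simp add: P)
    show "u = v" if "u \<in> grid t m" "v \<in> grid t m" "peak k t m b B u x \<noteq> 0" "peak k t m b B v x \<noteq> 0" for u v x
      using cell_bump_disjoint[OF k _ that(1,2) peak_nonzero_imp[OF that(3)] peak_nonzero_imp[OF that(4)]] by simp
    fix u assume u: "u \<in> grid t m"
    have "real n * (real m powr (- 2 * (b * B)) * (p_max * (1 / real m) ^ t)) =
        real n * p_max / real m powr (2 * (b * B) + real t)"
      using m by (simp add: powr_add powr_minus power_divide mt field_simps)
    also have "\<dots> \<le> 1" using fine m by simp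
    finally have le1: "real n * (real m powr (- 2 * (b * B)) * (p_max * (1 / real m) ^ t)) \<le> 1" .
    have "of_nat n * (\<integral>\<^sup>+x. ennreal ((peak k t m b B u x)\<^sup>2) \<partial>P) \<le>
        of_nat n * ennreal ((real m powr (- b * B))\<^sup>2 * (p_max * (1 / real m) ^ t))"
      using peak_energy_upper[OF P p p_pos p_bounds k t m B u] by (rule mult_left_mono) simp_all
    also have "\<dots> = ennreal (real n * (real m powr (- 2 * (b * B)) * (p_max * (1 / real m) ^ t)))"
      unfolding sq ennreal_of_nat_eq_real_of_nat by (rule ennreal_mult'[symmetric]) simp
    also have "\<dots> \<le> ennreal 1" using le1 by (rule ennreal_leI)
    finally show "of_nat n * (\<integral>\<^sup>+x. ennreal ((peak k t m b B u x)\<^sup>2) \<partial>P) \<le> 1" by simp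
  qed (rule finite_grid)
  then obtain W where W: "W \<subseteq> grid t m"
    "ennreal (5 / 32) * (\<Sum>u\<in>grid t m. \<integral>\<^sup>+x. ennreal ((peak k t m b B u x)\<^sup>2) \<partial>P) \<le>
      risk P n est (\<lambda>x. \<Sum>u\<in>W. peak k t m b B u x)"
    by blast
  have "p_min * (1 / 2) ^ t * ((\<kappa> ^ t) powr B)\<^sup>2 * real m powr (- 2 * (b * B)) =
      real (card (grid t m)) * ((real m powr (- b * B) * (\<kappa> ^ t) powr B)\<^sup>2 * (p_min * (1 / (2 * real m)) ^ t))"
    unfolding power_mult_distrib sq card_grid using m by (simp add: power_divide power_mult_distrib field_simps)
  also have "ennreal \<dots> = (\<Sum>u\<in>grid t m. ennreal ((real m powr (- b * B) * (\<kappa> ^ t) powr B)\<^sup>2 * (p_min * (1 / (2 * real m)) ^ t)))"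
    using p_pos by (simp add: ennreal_mult ennreal_of_nat_eq_real_of_nat)
  also have "\<dots> \<le> (\<Sum>u\<in>grid t m. \<integral>\<^sup>+x. ennreal ((peak k t m b B u x)\<^sup>2) \<partial>P)"
    by (intro sum_mono peak_energy_lower[OF P p p_pos p_bounds k t m B])
  finally have "ennreal (5 / 32) * ennreal (p_min * (1 / 2) ^ t * ((\<kappa> ^ t) powr B)\<^sup>2 * real m powr (- 2 * (b * B))) \<le>
      ennreal (5 / 32) * (\<Sum>u\<in>grid t m. \<integral>\<^sup>+x. ennreal ((peak k t m b B u x)\<^sup>2) \<partial>P)"
    by (rule mult_left_mono) simp
  also note W(2)
  finally have "ennreal (5 / 32) * ennreal (p_min * (1 / 2) ^ t * ((\<kappa> ^ t) powr B)\<^sup>2 * real m powr (- 2 * (b * B))) \<le>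
      risk P n est (\<lambda>x. \<Sum>u\<in>W. peak k t m b B u x)" .
  moreover have "ennreal (5 / 32 * X) = ennreal (5 / 32) * ennreal X" for X
    by (rule ennreal_mult') simp
  ultimately show ?thesis
    using W(1) unfolding sum_peak_eq[OF k W(1)] by auto
qed

section \<open>The minimax lower bound\<close>

text \<open>
  Rounding \<open>y powr (1 / e)\<close> up to an integer at most doubles it, since it is at least 1.
\<close>

lemma grid_size_exists:
  fixes y a e :: real
  assumes "1 \<le> y" "0 < e" "0 \<le> a"
  shows "\<exists>m::nat. 1 \<le> m \<and> y \<le> real m powr e \<and> 2 powr (- a) * y powr (- a / e) \<le> real m powr (- a)"
proof -
  define r where "r = y powr (1 / e)"
  have r: "1 \<le> r" using assms by (auto simp: r_def intro!: ge_one_powr_ge_zero)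
  define m where "m = nat \<lceil>r\<rceil>"
  have m: "r \<le> real m" "real m \<le> 2 * r" "1 \<le> m" using r by (auto simp: m_def) linarith+
  have "y = r powr e" using assms by (simp add: r_def powr_powr)
  also have "\<dots> \<le> real m powr e" using assms r m by (intro powr_mono2) auto
  finally have "y \<le> real m powr e" .
  moreover have "2 powr (- a) * y powr (- a / e) = (2 * r) powr (- a)"
    using assms r by (simp add: powr_mult) (simp add: r_def powr_powr)
  moreover have "(2 * r) powr (- a) \<le> real m powr (- a)"
    using assms r m by (intro powr_mono2') auto
  ultimately show ?thesis using m(3) by auto
qed

text \<open>
  The perturbations of the layer \<open>l\<close> alone give the term of the maximum that belongs to \<open>l\<close>. The grid
  size depends on \<open>n\<close>, but neither the Hoelder balls nor the constants do.
\<close>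

lemma single_layer_lower_bound:
  fixes q :: nat and d t :: "nat \<Rightarrow> nat" and \<beta> :: "nat \<Rightarrow> real"
  assumes prob: "prob_space P" and P: "P = density (lebesgue_cube (d 0)) (\<lambda>x. ennreal (p x))"
    and p: "p \<in> borel_measurable (lebesgue_cube (d 0))"
    and p_pos: "0 < p_min" "0 < p_max"
    and p_bounds: "\<And>x. x \<in> cube 0 1 (d 0) \<Longrightarrow> p_min \<le> p x \<and> p x \<le> p_max"
    and d: "d (Suc q) = 1" and t: "\<And>i. i \<le> q \<Longrightarrow> 1 \<le> t i \<and> t i \<le> d i"
    and l: "l \<le> q" and t_l: "\<And>i. i < l \<Longrightarrow> t l \<le> d i"
    and \<beta>: "\<And>i. i \<le> q \<Longrightarrow> 0 < \<beta> i"
    and K: "1 \<le> K" "\<And>i. i \<le> q \<Longrightarrow> 2 * real (t i) * real (holder_terms (t i) (\<beta> i)) \<le> K"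
  shows "\<exists>c > 0. \<forall>n \<ge> 1. ennreal (c * real n powr
      (- (2 * effective_smoothness q \<beta> l) / (2 * effective_smoothness q \<beta> l + real (t l)))) \<le>
    (INF est \<in> estimators (d 0) n. SUP f0 \<in> composition_class q d t \<beta> K. risk P n est f0)"
proof -
  define term_rate where "term_rate i n = real n powr
      (- (2 * effective_smoothness q \<beta> i) / (2 * effective_smoothness q \<beta> i + real (t i)))" for i n
  define T where "T = t l"
  define b where "b = \<beta> l"
  define B where "B = (\<Prod>i\<in>{l<..q}. min (\<beta> i) 1)"
  have B: "0 < B" unfolding B_def using \<beta> by (intro prod_pos) auto
  have b: "0 < b" using \<beta>[OF l] by (simp add: b_def)
  have es: "effective_smoothness q \<beta> l = b * B" by (simp add: effective_smoothness_def b_def B_def)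
  have T: "1 \<le> T" using t[OF l] by (simp add: T_def)
  have Td: "T \<le> d 0" using t[OF l] t_l[of 0] by (cases "l = 0") (auto simp: T_def)
  have K': "real (holder_terms (t i) (\<beta> i)) \<le> K" if "i \<le> q" for i
  proof -
    have "real (holder_terms (t i) (\<beta> i)) \<le> 2 * real (t i) * real (holder_terms (t i) (\<beta> i))"
      using t[OF that] by (intro mult_le_cancel_right1[THEN iffD2]) auto
    then show ?thesis using K(2)[OF that] by simp
  qed
  obtain \<kappa> k where k: "smooth_bump (strict_floor b) \<kappa> k" using smooth_bump_exists by blast
  then have \<kappa>: "0 < \<kappa>" by (simp add: smooth_bump_def)
  define M where "M = max 1 p_max"
  define e where "e = 2 * (b * B) + real T"
  have e: "0 < e" using b B by (simp add: e_def add_pos_nonneg)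
  define A where "A = 5 / 32 * (p_min * (1 / 2) ^ T * ((\<kappa> ^ T) powr B)\<^sup>2)"
  have A: "0 < A" unfolding A_def using \<kappa> p_pos by (intro mult_pos_pos zero_less_power) auto
  \<comment> \<open>The factor 2 in \<open>c\<close> pays for rounding the grid size, the factor \<open>M\<close> for an upper bound of the
    design density.\<close>
  define c where "c = A * (2 powr (- (2 * (b * B))) * M powr (- (2 * (b * B)) / e))"
  have "0 < c" using A by (auto simp: c_def M_def)
  moreover have "ennreal (c * term_rate l n) \<le>
      (INF est \<in> estimators (d 0) n. SUP f0 \<in> composition_class q d t \<beta> K. risk P n est f0)" if n: "1 \<le> n" for n
  proof (rule INF_greatest)
    fix est assume est: "est \<in> estimators (d 0) n"
    have Mn: "1 \<le> M * real n"
      using n mult_mono[of 1 M 1 "real n"] by (simp add: M_def)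
    obtain m :: nat where m: "1 \<le> m" "M * real n \<le> real m powr e"
      "2 powr (- (2 * (b * B))) * (M * real n) powr (- (2 * (b * B)) / e) \<le> real m powr (- (2 * (b * B)))"
      using grid_size_exists[OF Mn e, of "2 * (b * B)"] b B by auto
    have "p_max * real n \<le> M * real n" unfolding M_def by (intro mult_right_mono) auto
    then have "real n * p_max \<le> real m powr (2 * (b * B) + real T)"
      using m(2) unfolding e_def by (simp add: mult.commute)
    from grid_lower_bound[OF prob P p p_pos p_bounds k Td m(1) less_imp_le[OF B] est this]
    obtain W where W: "W \<subseteq> grid T m" and risk:
      "ennreal (5 / 32 * (p_min * (1 / 2) ^ T * ((\<kappa> ^ T) powr B)\<^sup>2 * real m powr (- 2 * (b * B)))) \<le>
        risk P n est (\<lambda>x. (real m powr (- b) * bump_sum k T m W (\<lambda>_. 0) x) powr B)"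
      by blast
    define \<phi> where "\<phi> x = real m powr (- b) * bump_sum k T m W (\<lambda>_. 0) x" for x
    have "(\<lambda>x. \<phi> x powr B) \<in> composition_class q d t \<beta> K"
    proof (rule single_layer_in_composition_class[where l = l and \<phi> = \<phi>])
      show "\<phi> \<in> holder_ball 0 1 (t l) (\<beta> l) K"
        using bump_sum_in_holder_ball[OF b k W _ m(1)] T K(2)[OF l] holder_ball_mono
        unfolding \<phi>_def[abs_def] T_def b_def by auto
      show "\<phi> y \<in> {0..1}" for y
      proof -
        have "0 \<le> bump_sum k T m W (\<lambda>_. 0) y"
          unfolding bump_sum_def by (intro sum_nonneg cell_bump_nonneg[OF k])
        moreover have "bump_sum k T m W (\<lambda>_. 0) y \<le> 1"
          using abs_bump_sum_le[OF k _ W, of "\<lambda>_. 0" y] by simp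
        moreover have "real m powr (- b) \<le> real m powr 0"
          using m(1) b by (intro powr_mono) auto
        ultimately show ?thesis using m(1) by (auto simp: \<phi>_def intro!: mult_le_one)
      qed
      show "\<phi> x powr B = \<phi> (\<lambda>k\<in>{..<t l}. x k) powr (\<Prod>i\<in>{l<..q}. min (\<beta> i) 1)" for x
        by (simp add: \<phi>_def bump_sum_def B_def[symmetric] T_def[symmetric] cell_bump_restrict)
    qed (use d \<beta> t l t_l K K' in auto)
    then have "risk P n est (\<lambda>x. \<phi> x powr B) \<le> (SUP f0 \<in> composition_class q d t \<beta> K. risk P n est f0)"
      by (rule SUP_upper)
    moreover have "c * term_rate l n \<le>
        5 / 32 * (p_min * (1 / 2) ^ T * ((\<kappa> ^ T) powr B)\<^sup>2 * real m powr (- 2 * (b * B)))"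
    proof -
      have "c * term_rate l n = A * (2 powr (- (2 * (b * B))) * (M * real n) powr (- (2 * (b * B)) / e))"
        by (simp add: c_def term_rate_def es e_def T_def M_def powr_mult)
      also have "\<dots> \<le> A * real m powr (- (2 * (b * B)))"
        using m(3) A by (intro mult_left_mono) auto
      finally show ?thesis by (simp add: A_def)
    qed
    ultimately show "ennreal (c * term_rate l n) \<le> (SUP f0 \<in> composition_class q d t \<beta> K. risk P n est f0)"
      using risk unfolding \<phi>_def by (meson ennreal_leI order_trans)
  qed
  ultimately show ?thesis by (auto simp: term_rate_def)
qed

theorem theorem3:
  fixes q :: nat
    and d t :: "nat \<Rightarrow> nat"
    and \<beta> :: "nat \<Rightarrow> real"
    and P :: "(nat \<Rightarrow> real) measure"
    and p :: "(nat \<Rightarrow> real) \<Rightarrow> real"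
    and p_min p_max :: real
  assumes "prob_space P"
    and "P = density (lebesgue_cube (d 0)) (\<lambda>x. ennreal (p x))"
    and "p \<in> borel_measurable (lebesgue_cube (d 0))"
    and "0 < p_min" and "0 < p_max"
    and "\<forall>x \<in> cube 0 1 (d 0). p_min \<le> p x \<and> p x \<le> p_max"
    and "d (Suc q) = 1"
    and "\<forall>i \<le> q. 1 \<le> t i \<and> t i \<le> d i"
    and "\<forall>i \<in> {1..q}. t i \<le> Min (d ` {..<i})"
    and "\<forall>i \<le> q. 0 < \<beta> i"
  shows "\<forall>\<^sub>F K in at_top. \<exists>c > 0. \<forall>n \<ge> 1.
           (INF est \<in> estimators (d 0) n. SUP f0 \<in> composition_class q d t \<beta> K. risk P n est f0)
             \<ge> ennreal (c * rate q t \<beta> n)"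
proof -
  define term_rate where "term_rate i n = real n powr
      (- (2 * effective_smoothness q \<beta> i) / (2 * effective_smoothness q \<beta> i + real (t i)))" for i n
  define K0 where "K0 i = 2 * real (t i) * real (holder_terms (t i) (\<beta> i))" for i
  have t_l: "t l \<le> d i" if "l \<le> q" "i < l" for l i
  proof -
    have "t l \<le> Min (d ` {..<l})" using assms(9) that by auto
    also have "\<dots> \<le> d i" using that by (intro Min_le) auto
    finally show ?thesis .
  qed
  have layer: "\<exists>c > 0. \<forall>n \<ge> 1. ennreal (c * term_rate l n) \<le>
      (INF est \<in> estimators (d 0) n. SUP f0 \<in> composition_class q d t \<beta> K. risk P n est f0)"
    if "l \<le> q" "1 \<le> K" "\<And>i. i \<le> q \<Longrightarrow> K0 i \<le> K" for l K
    unfolding term_rate_def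
    by (rule single_layer_lower_bound[where d = d and p = p, OF assms(1-5)]) (use assms(6-8,10) t_l that in \<open>auto simp: K0_def\<close>)
  have "\<exists>c > 0. \<forall>n \<ge> 1. ennreal (c * rate q t \<beta> n) \<le>
      (INF est \<in> estimators (d 0) n. SUP f0 \<in> composition_class q d t \<beta> K. risk P n est f0)"
    if K: "1 \<le> K" "\<And>i. i \<le> q \<Longrightarrow> K0 i \<le> K" for K
  proof -
    obtain c where c: "\<And>l. l \<le> q \<Longrightarrow> 0 < c l" "\<And>l n. l \<le> q \<Longrightarrow> 1 \<le> n \<Longrightarrow> ennreal (c l * term_rate l n) \<le>
        (INF est \<in> estimators (d 0) n. SUP f0 \<in> composition_class q d t \<beta> K. risk P n est f0)"
      using layer[OF _ K] by metis
    have "0 < Min (c ` {..q})" using c(1) by (subst Min_gr_iff) auto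
    moreover have "ennreal (Min (c ` {..q}) * rate q t \<beta> n) \<le>
        (INF est \<in> estimators (d 0) n. SUP f0 \<in> composition_class q d t \<beta> K. risk P n est f0)" if n: "1 \<le> n" for n
    proof -
      have "rate q t \<beta> n \<in> (\<lambda>l. term_rate l n) ` {..q}"
        unfolding rate_def term_rate_def by (intro Max_in) auto
      then obtain l where l: "l \<le> q" "rate q t \<beta> n = term_rate l n" by auto
      have "Min (c ` {..q}) * rate q t \<beta> n \<le> c l * term_rate l n"
        using l by (auto simp: term_rate_def intro!: mult_right_mono Min_le)
      then show ?thesis using c(2)[OF l(1) n] by (meson ennreal_leI order_trans)
    qed
    ultimately show ?thesis by blast
  qed
  moreover have "\<forall>\<^sub>F K in at_top. 1 \<le> K \<and> (\<forall>i\<in>{..q}. K0 i \<le> K)"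
    by (intro eventually_conj eventually_ge_at_top eventually_ball_finite) (auto intro: eventually_ge_at_top)
  ultimately show ?thesis
    by (elim eventually_mono) auto
qed

end
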